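(* Let $G$ be a finite group with a cyclic quotient of order $pq$ for two distinct odd primes $p$ and $q$. Then $a_G \geq 2$ and $LO(G) \neq 0$.
   Context: Two elements $g,h \in G$ are real conjugate if $g$ or $g^{-1}$ is conjugate to $h$; the Laitinen number $a_G$ is the number of real conjugacy classes of elements of $G$ whose order is not a prime power (the identity counts as having prime power order). Real $G$-modules are finite-dimensional real vector spaces with linear $G$-action; $RO(G)$ is the real representation ring. For a prime $p$, $O^p(G)$ is the smallest normal subgroup of $G$ with $p$-power index. A subgroup $H \le G$ is large if $O^p(G) \le H$ for some prime $p$. A real $G$-module $V$ is $\mathcal{L}$-free if $\dim V^H = 0$ for all large subgroups $H$ of $G$. $LO(G) \subseteq RO(G)$ is the subgroup of differences $U - V$ of real $\mathcal{L}$-free $G$-modules $U$, $V$ that are isomorphic as $P$-modules for every subgroup $P\le G$ of prime power order (including the trivial subgroup). *)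

theory Defs
  imports "HOL-Algebra.Elementary_Groups" "HOL-Algebra.Multiplicative_Group" "Jordan_Normal_Form.VS_Connect"
begin

definition prime_power :: "nat \<Rightarrow> bool"
  where "prime_power n \<longleftrightarrow> (\<exists>p k. prime p \<and> n = p ^ k)"

definition conjugate :: "('g, 'b) monoid_scheme \<Rightarrow> 'g \<Rightarrow> 'g \<Rightarrow> bool"
  where "conjugate G g h \<longleftrightarrow> (\<exists>x\<in>carrier G. h = x \<otimes>\<^bsub>G\<^esub> g \<otimes>\<^bsub>G\<^esub> inv\<^bsub>G\<^esub> x)"

definition real_conj :: "('g, 'b) monoid_scheme \<Rightarrow> ('g \<times> 'g) set"
  where "real_conj G = {(g, h). g \<in> carrier G \<and> h \<in> carrier G \<and>
                          (conjugate G g h \<or> conjugate G (inv\<^bsub>G\<^esub> g) h)}"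

definition laitinen_number :: "('g, 'b) monoid_scheme \<Rightarrow> nat"
  where "laitinen_number G =
    card ({g \<in> carrier G. \<not> prime_power (group.ord G g)} // real_conj G)"

text \<open>\<open>p_residual G p\<close> is \<open>O\<^sup>p(G)\<close>; \<open>LEAST\<close> refers to the order \<open>\<subseteq>\<close> on sets.\<close>

definition p_residual :: "('g, 'b) monoid_scheme \<Rightarrow> nat \<Rightarrow> 'g set"
  where "p_residual G p = (LEAST N. N \<lhd> G \<and> (\<exists>k. card (rcosets\<^bsub>G\<^esub> N) = p ^ k))"

definition large_subgroup :: "('g, 'b) monoid_scheme \<Rightarrow> 'g set \<Rightarrow> bool"
  where "large_subgroup G H \<longleftrightarrow> subgroup H G \<and> (\<exists>p. prime p \<and> p_residual G p \<subseteq> H)"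

text \<open>A finite-dimensional real \<open>G\<close>-module is given in coordinates, as a pair \<open>(n, \<rho>)\<close>
  where \<open>\<rho>\<close> is a homomorphism from \<open>G\<close> to \<open>GL\<^sub>n(\<real>)\<close>; values of \<open>\<rho>\<close> outside the carrier
  are irrelevant. The case \<open>n = 0\<close> is the zero module. Every finite-dimensional real
  \<open>G\<close>-module is isomorphic to one of this form.\<close>

type_synonym 'g gmod = "nat \<times> ('g \<Rightarrow> real mat)"

definition real_gmod :: "('g, 'b) monoid_scheme \<Rightarrow> 'g gmod \<Rightarrow> bool"
  where "real_gmod G V \<longleftrightarrow> snd V \<in> hom G (units_of (ring_mat TYPE(real) (fst V) ()))"

definition gmod_sum :: "'g gmod \<Rightarrow> 'g gmod \<Rightarrow> 'g gmod"  (infixl \<open>\<oplus>\<^sub>m\<close> 65)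
  where "U \<oplus>\<^sub>m V = (fst U + fst V,
    \<lambda>g. four_block_mat (snd U g) (0\<^sub>m (fst U) (fst V)) (0\<^sub>m (fst V) (fst U)) (snd V g))"

definition gmod_zero :: "'g gmod"
  where "gmod_zero = (0, \<lambda>g. 1\<^sub>m 0)"

text \<open>Isomorphism of the restrictions to \<open>H\<close>: the matrix \<open>T\<close> is a linear bijection,
  with inverse \<open>S\<close>, commuting with the action of \<open>H\<close>.\<close>

definition gmod_iso :: "'g set \<Rightarrow> 'g gmod \<Rightarrow> 'g gmod \<Rightarrow> bool"
  where "gmod_iso H U V \<longleftrightarrow>
    (\<exists>T \<in> carrier_mat (fst V) (fst U). \<exists>S \<in> carrier_mat (fst U) (fst V).
       T * S = 1\<^sub>m (fst V) \<and> S * T = 1\<^sub>m (fst U) \<and>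
       (\<forall>h\<in>H. T * snd U h = snd V h * T))"

definition fixed_space :: "'g set \<Rightarrow> 'g gmod \<Rightarrow> real vec set"
  where "fixed_space H V = {v \<in> carrier_vec (fst V). \<forall>h\<in>H. snd V h *\<^sub>v v = v}"

definition fixed_dim :: "'g set \<Rightarrow> 'g gmod \<Rightarrow> nat"
  where "fixed_dim H V =
    vectorspace.dim class_ring (module_vec TYPE(real) (fst V)\<lparr>carrier := fixed_space H V\<rparr>)"

definition large_free :: "('g, 'b) monoid_scheme \<Rightarrow> 'g gmod \<Rightarrow> bool"
  where "large_free G V \<longleftrightarrow> (\<forall>H. large_subgroup G H \<longrightarrow> fixed_dim H V = 0)"

text \<open>The Grothendieck group of a commutative monoid, written multiplicatively; the class of
  \<open>(a, b)\<close> is the formal quotient of \<open>a\<close> by \<open>b\<close>.\<close>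

definition groth_rel :: "('a, 'b) monoid_scheme \<Rightarrow> (('a \<times> 'a) \<times> ('a \<times> 'a)) set"
  where "groth_rel M = {((a, b), (c, d)).
    a \<in> carrier M \<and> b \<in> carrier M \<and> c \<in> carrier M \<and> d \<in> carrier M \<and>
    (\<exists>k\<in>carrier M. a \<otimes>\<^bsub>M\<^esub> d \<otimes>\<^bsub>M\<^esub> k = c \<otimes>\<^bsub>M\<^esub> b \<otimes>\<^bsub>M\<^esub> k)}"

definition groth_class :: "('a, 'b) monoid_scheme \<Rightarrow> 'a \<Rightarrow> 'a \<Rightarrow> ('a \<times> 'a) set"
  where "groth_class M a b = groth_rel M `` {(a, b)}"

definition groth :: "('a, 'b) monoid_scheme \<Rightarrow> ('a \<times> 'a) set monoid"
  where "groth M = \<lparr>carrier = (carrier M \<times> carrier M) // groth_rel M,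
    mult = (\<lambda>A B. \<Union>(a, b)\<in>A. \<Union>(c, d)\<in>B. groth_class M (a \<otimes>\<^bsub>M\<^esub> c) (b \<otimes>\<^bsub>M\<^esub> d)),
    one = groth_class M \<one>\<^bsub>M\<^esub> \<one>\<^bsub>M\<^esub>\<rparr>"

definition gmod_rel :: "('g, 'b) monoid_scheme \<Rightarrow> ('g gmod \<times> 'g gmod) set"
  where "gmod_rel G = {(U, V). real_gmod G U \<and> real_gmod G V \<and> gmod_iso (carrier G) U V}"

definition gmod_class :: "('g, 'b) monoid_scheme \<Rightarrow> 'g gmod \<Rightarrow> 'g gmod set"
  where "gmod_class G V = gmod_rel G `` {V}"

definition gmod_monoid :: "('g, 'b) monoid_scheme \<Rightarrow> 'g gmod set monoid"
  where "gmod_monoid G = \<lparr>carrier = Collect (real_gmod G) // gmod_rel G,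
    mult = (\<lambda>A B. \<Union>U\<in>A. \<Union>V\<in>B. gmod_class G (U \<oplus>\<^sub>m V)),
    one = gmod_class G gmod_zero\<rparr>"

text \<open>Only the additive group of the representation ring is needed. It is a record of type
  \<^typ>\<open>'a monoid\<close>, so its operation is written \<open>\<otimes>\<close> and its zero element \<open>\<one>\<close>.\<close>

definition RO :: "('g, 'b) monoid_scheme \<Rightarrow> ('g gmod set \<times> 'g gmod set) set monoid"
  where "RO G = groth (gmod_monoid G)"

definition gmod_diff ::
  "('g, 'b) monoid_scheme \<Rightarrow> 'g gmod \<Rightarrow> 'g gmod \<Rightarrow> ('g gmod set \<times> 'g gmod set) set"
  where "gmod_diff G U V = groth_class (gmod_monoid G) (gmod_class G U) (gmod_class G V)"

definition LO :: "('g, 'b) monoid_scheme \<Rightarrow> ('g gmod set \<times> 'g gmod set) set set"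
  where "LO G = {gmod_diff G U V | U V.
    real_gmod G U \<and> real_gmod G V \<and> large_free G U \<and> large_free G V \<and>
    (\<forall>P. subgroup P G \<and> prime_power (card P) \<longrightarrow> gmod_iso P U V)}"

lemma equiv_real_conj:
  assumes "group G"
  shows "equiv (carrier G) (real_conj G)"
proof -
  interpret group G by fact
  have refl: "conjugate G g g" if "g \<in> carrier G" for g
    unfolding conjugate_def using that by (intro bexI[of _ "\<one>\<^bsub>G\<^esub>"]) auto
  have sym: "conjugate G h g" if a: "conjugate G g h" "g \<in> carrier G" for g h
  proof -
    obtain x where x: "x \<in> carrier G" "h = x \<otimes>\<^bsub>G\<^esub> g \<otimes>\<^bsub>G\<^esub> inv\<^bsub>G\<^esub> x"
      using a unfolding conjugate_def by blast
    have "inv\<^bsub>G\<^esub> x \<otimes>\<^bsub>G\<^esub> h \<otimes>\<^bsub>G\<^esub> inv\<^bsub>G\<^esub> (inv\<^bsub>G\<^esub> x)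
        = (inv\<^bsub>G\<^esub> x \<otimes>\<^bsub>G\<^esub> x) \<otimes>\<^bsub>G\<^esub> g \<otimes>\<^bsub>G\<^esub> (inv\<^bsub>G\<^esub> x \<otimes>\<^bsub>G\<^esub> x)"
      unfolding x(2) using x(1) a(2) by (simp add: m_assoc) (simp flip: m_assoc)
    also have "\<dots> = g"
      using x(1) a(2) by simp
    finally have "\<exists>y\<in>carrier G. g = y \<otimes>\<^bsub>G\<^esub> h \<otimes>\<^bsub>G\<^esub> inv\<^bsub>G\<^esub> y"
      using x(1) by (metis inv_closed)
    then show ?thesis
      unfolding conjugate_def .
  qed
  have trans: "conjugate G g k" if a: "conjugate G g h" "conjugate G h k" "g \<in> carrier G" for g h k
  proof -
    obtain x y where x: "x \<in> carrier G" "h = x \<otimes>\<^bsub>G\<^esub> g \<otimes>\<^bsub>G\<^esub> inv\<^bsub>G\<^esub> x"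
      and y: "y \<in> carrier G" "k = y \<otimes>\<^bsub>G\<^esub> h \<otimes>\<^bsub>G\<^esub> inv\<^bsub>G\<^esub> y"
      using a unfolding conjugate_def by blast
    have "k = (y \<otimes>\<^bsub>G\<^esub> x) \<otimes>\<^bsub>G\<^esub> g \<otimes>\<^bsub>G\<^esub> inv\<^bsub>G\<^esub> (y \<otimes>\<^bsub>G\<^esub> x)"
      unfolding x(2) y(2) using x(1) y(1) a(3) by (simp add: m_assoc inv_mult_group)
    then show ?thesis
      unfolding conjugate_def using x y by blast
  qed
  have inv: "conjugate G (inv\<^bsub>G\<^esub> g) (inv\<^bsub>G\<^esub> h)" if a: "conjugate G g h" "g \<in> carrier G" for g h
  proof -
    obtain x where x: "x \<in> carrier G" "h = x \<otimes>\<^bsub>G\<^esub> g \<otimes>\<^bsub>G\<^esub> inv\<^bsub>G\<^esub> x"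
      using a unfolding conjugate_def by blast
    have "inv\<^bsub>G\<^esub> h = x \<otimes>\<^bsub>G\<^esub> inv\<^bsub>G\<^esub> g \<otimes>\<^bsub>G\<^esub> inv\<^bsub>G\<^esub> x"
      unfolding x(2) using x(1) a(2) by (simp add: m_assoc inv_mult_group)
    then show ?thesis
      unfolding conjugate_def using x by blast
  qed
  show ?thesis
  proof (rule equivI)
    show "real_conj G \<subseteq> carrier G \<times> carrier G"
      by (auto simp: real_conj_def)
    show "refl_on (carrier G) (real_conj G)"
      using refl by (auto simp: refl_on_def real_conj_def)
    show "sym (real_conj G)"
    proof (rule symI)
      fix g h assume "(g, h) \<in> real_conj G"
      then have gh: "g \<in> carrier G" "h \<in> carrier G" "conjugate G g h \<or> conjugate G (inv\<^bsub>G\<^esub> g) h"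
        by (auto simp: real_conj_def)
      then have "conjugate G h g \<or> conjugate G (inv\<^bsub>G\<^esub> h) g"
        using sym[of g h] sym[of "inv\<^bsub>G\<^esub> g" h] inv[of h "inv\<^bsub>G\<^esub> g"] by auto
      with gh show "(h, g) \<in> real_conj G"
        by (simp add: real_conj_def)
    qed
    show "trans (real_conj G)"
    proof (rule transI)
      fix g h k assume "(g, h) \<in> real_conj G" "(h, k) \<in> real_conj G"
      then have gh: "g \<in> carrier G" "h \<in> carrier G" "k \<in> carrier G"
        "conjugate G g h \<or> conjugate G (inv\<^bsub>G\<^esub> g) h" "conjugate G h k \<or> conjugate G (inv\<^bsub>G\<^esub> h) k"
        by (auto simp: real_conj_def)
      then have "conjugate G g k \<or> conjugate G (inv\<^bsub>G\<^esub> g) k"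
        using trans[of g h k] trans[of "inv\<^bsub>G\<^esub> g" h k] inv[of g h] inv[of "inv\<^bsub>G\<^esub> g" h]
          trans[of g "inv\<^bsub>G\<^esub> h" k] trans[of "inv\<^bsub>G\<^esub> g" "inv\<^bsub>G\<^esub> h" k]
        by auto
      with gh show "(g, k) \<in> real_conj G"
        by (simp add: real_conj_def)
    qed
  qed
qed

lemma p_residual_least:
  assumes "group G" "finite (carrier G)" "prime p"
  shows "p_residual G p \<lhd> G"
    and "\<exists>k. card (rcosets\<^bsub>G\<^esub> (p_residual G p)) = p ^ k"
    and "\<And>N k. N \<lhd> G \<Longrightarrow> card (rcosets\<^bsub>G\<^esub> N) = p ^ k \<Longrightarrow> p_residual G p \<subseteq> N"
proof -
  interpret group G by fact
  define S where "S = {N. N \<lhd> G \<and> (\<exists>k. card (rcosets\<^bsub>G\<^esub> N) = p ^ k)}"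
  have S_sub: "N \<subseteq> carrier G" if "N \<in> S" for N
    using that by (auto simp: S_def dest: normal_imp_subgroup subgroup.subset)
  have top: "carrier G \<in> S"
  proof -
    have "carrier G \<lhd> G"
      by (simp add: normal_inv_iff subgroup_self)
    moreover have "rcosets\<^bsub>G\<^esub> (carrier G) = {carrier G}"
      by (auto simp: RCOSETS_def coset_join2 subgroup_self)
    ultimately show ?thesis
      unfolding S_def by (auto intro!: exI[of _ 0])
  qed
  have inter: "N \<inter> M \<in> S" if N: "N \<in> S" and M: "M \<in> S" for N M
  proof -
    interpret N: normal N G using N by (simp add: S_def)
    interpret M: normal M G using M by (simp add: S_def)
    let ?Q = "(G Mod N) \<times>\<times> (G Mod M)" and ?h = "\<lambda>x. (N #>\<^bsub>G\<^esub> x, M #>\<^bsub>G\<^esub> x)"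
    have gQ: "group ?Q"
      by (intro DirProd_group N.factorgroup_is_group M.factorgroup_is_group)
    interpret h: group_hom G ?Q ?h
    proof (unfold_locales)
      show "?h \<in> hom G ?Q"
        using N.r_coset_hom_Mod M.r_coset_hom_Mod
        by (auto simp: hom_def DirProd_def)
    qed (use gQ in \<open>auto simp: group_def monoid_def group_axioms_def\<close>)
    have ker: "kernel G ?Q ?h = N \<inter> M"
      using coset_join1[OF _ _ N.subgroup_axioms] coset_join1[OF _ _ M.subgroup_axioms]
        coset_join2[OF _ N.subgroup_axioms] coset_join2[OF _ M.subgroup_axioms]
        N.subset M.subset
      by (auto simp: kernel_def DirProd_def)
    have norm: "N \<inter> M \<lhd> G"
      using h.normal_kernel ker by simp
    let ?R = "?Q\<lparr>carrier := ?h ` carrier G\<rparr>"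
    have "?h \<in> hom G ?R"
      using h.homh by (auto simp: hom_def)
    then interpret r: group_hom G ?R ?h
      by (intro group_hom.intro group_hom_axioms.intro is_group
          group.subgroup_imp_group[OF gQ h.img_is_subgroup])
    have "kernel G ?R ?h = N \<inter> M"
      using ker by (simp add: kernel_def)
    then have "G Mod (N \<inter> M) \<cong> ?R"
      using r.FactGroup_iso by simp
    then have "card (rcosets\<^bsub>G\<^esub> (N \<inter> M)) = card (?h ` carrier G)"
      by (drule_tac iso_same_card) (simp add: FactGroup_def)
    also have "\<dots> dvd Coset.order ?Q"
      unfolding group.lagrange[OF gQ h.img_is_subgroup, symmetric] by (rule dvd_triv_right)
    also have "Coset.order ?Q = card (rcosets\<^bsub>G\<^esub> N) * card (rcosets\<^bsub>G\<^esub> M)"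
      by (simp add: Coset.order_def DirProd_def FactGroup_def card_cartesian_product)
    finally obtain a b where "card (rcosets\<^bsub>G\<^esub> (N \<inter> M)) dvd p ^ (a + b)"
      using N M by (auto simp: S_def power_add)
    then have "\<exists>k. card (rcosets\<^bsub>G\<^esub> (N \<inter> M)) = p ^ k"
      using divides_primepow_nat[OF \<open>prime p\<close>] by blast
    then show ?thesis
      using norm by (simp add: S_def)
  qed
  have fin: "finite S"
    by (rule finite_subset[of _ "Pow (carrier G)"]) (use S_sub assms in auto)
  have "\<Inter> F \<in> S" if "finite F" "F \<noteq> {}" "F \<subseteq> S" for F
    using that by (induction F rule: finite_ne_induct) (auto intro: inter)
  then have I: "\<Inter> S \<in> S"
    using fin top by blast
  have eq: "p_residual G p = \<Inter> S"
    unfolding p_residual_def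
  proof (rule Least_equality)
    show "\<Inter> S \<lhd> G \<and> (\<exists>k. card (rcosets\<^bsub>G\<^esub> \<Inter> S) = p ^ k)"
      using I unfolding S_def by blast
  qed (auto simp: S_def)
  show "p_residual G p \<lhd> G" "\<exists>k. card (rcosets\<^bsub>G\<^esub> (p_residual G p)) = p ^ k"
    using I unfolding eq S_def by auto
  show "p_residual G p \<subseteq> N" if "N \<lhd> G" "card (rcosets\<^bsub>G\<^esub> N) = p ^ k" for N k
    using that unfolding eq S_def by blast
qed

lemma equiv_groth_rel:
  assumes "comm_monoid M"
  shows "equiv (carrier M \<times> carrier M) (groth_rel M)"
proof -
  interpret comm_monoid M by fact
  have tr: "\<exists>k\<in>carrier M. a \<otimes>\<^bsub>M\<^esub> f \<otimes>\<^bsub>M\<^esub> k = e \<otimes>\<^bsub>M\<^esub> b \<otimes>\<^bsub>M\<^esub> k"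
    if c: "a \<in> carrier M" "b \<in> carrier M" "c \<in> carrier M" "d \<in> carrier M" "e \<in> carrier M"
      "f \<in> carrier M" "k \<in> carrier M" "l \<in> carrier M"
      and 1: "a \<otimes>\<^bsub>M\<^esub> d \<otimes>\<^bsub>M\<^esub> k = c \<otimes>\<^bsub>M\<^esub> b \<otimes>\<^bsub>M\<^esub> k" and 2: "c \<otimes>\<^bsub>M\<^esub> f \<otimes>\<^bsub>M\<^esub> l = e \<otimes>\<^bsub>M\<^esub> d \<otimes>\<^bsub>M\<^esub> l"
    for a b c d e f k l
  proof
    have "a \<otimes>\<^bsub>M\<^esub> f \<otimes>\<^bsub>M\<^esub> (d \<otimes>\<^bsub>M\<^esub> k \<otimes>\<^bsub>M\<^esub> l) = (a \<otimes>\<^bsub>M\<^esub> d \<otimes>\<^bsub>M\<^esub> k) \<otimes>\<^bsub>M\<^esub> (f \<otimes>\<^bsub>M\<^esub> l)"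
      using c by (simp add: m_ac)
    also have "\<dots> = (c \<otimes>\<^bsub>M\<^esub> f \<otimes>\<^bsub>M\<^esub> l) \<otimes>\<^bsub>M\<^esub> (b \<otimes>\<^bsub>M\<^esub> k)"
      unfolding 1 using c by (simp add: m_ac)
    also have "\<dots> = e \<otimes>\<^bsub>M\<^esub> b \<otimes>\<^bsub>M\<^esub> (d \<otimes>\<^bsub>M\<^esub> k \<otimes>\<^bsub>M\<^esub> l)"
      unfolding 2 using c by (simp add: m_ac)
    finally show "a \<otimes>\<^bsub>M\<^esub> f \<otimes>\<^bsub>M\<^esub> (d \<otimes>\<^bsub>M\<^esub> k \<otimes>\<^bsub>M\<^esub> l) = e \<otimes>\<^bsub>M\<^esub> b \<otimes>\<^bsub>M\<^esub> (d \<otimes>\<^bsub>M\<^esub> k \<otimes>\<^bsub>M\<^esub> l)" .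
  qed (use c in auto)
  show ?thesis
  proof (rule equivI)
    show "groth_rel M \<subseteq> (carrier M \<times> carrier M) \<times> (carrier M \<times> carrier M)"
      by (auto simp: groth_rel_def)
    show "refl_on (carrier M \<times> carrier M) (groth_rel M)"
      by (auto simp: refl_on_def groth_rel_def)
    show "sym (groth_rel M)"
      by (rule symI) (clarsimp simp: groth_rel_def, metis)
    show "trans (groth_rel M)"
    proof (rule transI, clarify)
      fix a b c d e f
      assume 1: "((a, b), (c, d)) \<in> groth_rel M" and 2: "((c, d), (e, f)) \<in> groth_rel M"
      then obtain k l where "k \<in> carrier M" "l \<in> carrier M"
        "a \<otimes>\<^bsub>M\<^esub> d \<otimes>\<^bsub>M\<^esub> k = c \<otimes>\<^bsub>M\<^esub> b \<otimes>\<^bsub>M\<^esub> k" "c \<otimes>\<^bsub>M\<^esub> f \<otimes>\<^bsub>M\<^esub> l = e \<otimes>\<^bsub>M\<^esub> d \<otimes>\<^bsub>M\<^esub> l"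
        unfolding groth_rel_def by blast
      with tr[of a b c d e f k l] 1 2 show "((a, b), (e, f)) \<in> groth_rel M"
        unfolding groth_rel_def by blast
    qed
  qed
qed

lemma groth_class_eq_iff:
  assumes "comm_monoid M" "a \<in> carrier M" "b \<in> carrier M" "c \<in> carrier M" "d \<in> carrier M"
  shows "groth_class M a b = groth_class M c d \<longleftrightarrow>
    (\<exists>k\<in>carrier M. a \<otimes>\<^bsub>M\<^esub> d \<otimes>\<^bsub>M\<^esub> k = c \<otimes>\<^bsub>M\<^esub> b \<otimes>\<^bsub>M\<^esub> k)"
  unfolding groth_class_def
  using eq_equiv_class_iff[OF equiv_groth_rel[OF assms(1)], of "(a, b)" "(c, d)"] assms
  by (auto simp: groth_rel_def)

lemma groth_mult:
  assumes "comm_monoid M" "a \<in> carrier M" "b \<in> carrier M" "c \<in> carrier M" "d \<in> carrier M"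
  shows "groth_class M a b \<otimes>\<^bsub>groth M\<^esub> groth_class M c d
    = groth_class M (a \<otimes>\<^bsub>M\<^esub> c) (b \<otimes>\<^bsub>M\<^esub> d)"
proof -
  interpret comm_monoid M by fact
  have *: "groth_class M (a' \<otimes>\<^bsub>M\<^esub> c') (b' \<otimes>\<^bsub>M\<^esub> d') = groth_class M (a \<otimes>\<^bsub>M\<^esub> c) (b \<otimes>\<^bsub>M\<^esub> d)"
    if ab: "(a', b') \<in> groth_class M a b" and cd: "(c', d') \<in> groth_class M c d" for a' b' c' d'
  proof -
    obtain k where k: "a' \<in> carrier M" "b' \<in> carrier M" "k \<in> carrier M"
      "a \<otimes>\<^bsub>M\<^esub> b' \<otimes>\<^bsub>M\<^esub> k = a' \<otimes>\<^bsub>M\<^esub> b \<otimes>\<^bsub>M\<^esub> k"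
      using ab unfolding groth_class_def groth_rel_def by blast
    obtain l where l: "c' \<in> carrier M" "d' \<in> carrier M" "l \<in> carrier M"
      "c \<otimes>\<^bsub>M\<^esub> d' \<otimes>\<^bsub>M\<^esub> l = c' \<otimes>\<^bsub>M\<^esub> d \<otimes>\<^bsub>M\<^esub> l"
      using cd unfolding groth_class_def groth_rel_def by blast
    have "(a' \<otimes>\<^bsub>M\<^esub> c') \<otimes>\<^bsub>M\<^esub> (b \<otimes>\<^bsub>M\<^esub> d) \<otimes>\<^bsub>M\<^esub> (k \<otimes>\<^bsub>M\<^esub> l)
        = (a' \<otimes>\<^bsub>M\<^esub> b \<otimes>\<^bsub>M\<^esub> k) \<otimes>\<^bsub>M\<^esub> (c' \<otimes>\<^bsub>M\<^esub> d \<otimes>\<^bsub>M\<^esub> l)"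
      using assms k(1-3) l(1-3) by (simp add: m_ac)
    also have "\<dots> = (a \<otimes>\<^bsub>M\<^esub> b' \<otimes>\<^bsub>M\<^esub> k) \<otimes>\<^bsub>M\<^esub> (c \<otimes>\<^bsub>M\<^esub> d' \<otimes>\<^bsub>M\<^esub> l)"
      using k(4) l(4) by simp
    also have "\<dots> = (a \<otimes>\<^bsub>M\<^esub> c) \<otimes>\<^bsub>M\<^esub> (b' \<otimes>\<^bsub>M\<^esub> d') \<otimes>\<^bsub>M\<^esub> (k \<otimes>\<^bsub>M\<^esub> l)"
      using assms k(1-3) l(1-3) by (simp add: m_ac)
    finally show ?thesis
      using assms k(1-3) l(1-3) by (subst groth_class_eq_iff) (auto intro!: bexI[of _ "k \<otimes>\<^bsub>M\<^esub> l"])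
  qed
  have mem: "(a, b) \<in> groth_class M a b" "(c, d) \<in> groth_class M c d"
    using equiv_class_self[OF equiv_groth_rel[OF assms(1)], of "(a, b)"]
      equiv_class_self[OF equiv_groth_rel[OF assms(1)], of "(c, d)"] assms
    by (auto simp: groth_class_def)
  have "groth_class M a b \<otimes>\<^bsub>groth M\<^esub> groth_class M c d
      = (\<Union>(a', b')\<in>groth_class M a b. \<Union>(c', d')\<in>groth_class M c d.
           groth_class M (a' \<otimes>\<^bsub>M\<^esub> c') (b' \<otimes>\<^bsub>M\<^esub> d'))"
    by (simp add: groth_def)
  also have "\<dots> = (\<Union>(a', b')\<in>groth_class M a b. \<Union>(c', d')\<in>groth_class M c d.
           groth_class M (a \<otimes>\<^bsub>M\<^esub> c) (b \<otimes>\<^bsub>M\<^esub> d))"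
    by (intro SUP_cong refl) (auto simp: *)
  also have "\<dots> = groth_class M (a \<otimes>\<^bsub>M\<^esub> c) (b \<otimes>\<^bsub>M\<^esub> d)"
    using mem by auto
  finally show ?thesis .
qed

lemma groth_carrier:
  "carrier (groth M) = {groth_class M a b | a b. a \<in> carrier M \<and> b \<in> carrier M}"
  by (auto simp: groth_def groth_class_def quotient_def)

lemma comm_group_groth:
  assumes "comm_monoid M"
  shows "comm_group (groth M)"
proof -
  interpret comm_monoid M by fact
  have one: "\<one>\<^bsub>groth M\<^esub> = groth_class M \<one>\<^bsub>M\<^esub> \<one>\<^bsub>M\<^esub>"
    by (simp add: groth_def)
  show ?thesis
  proof (rule comm_groupI)
    fix x assume "x \<in> carrier (groth M)"
    then obtain a b where ab: "x = groth_class M a b" "a \<in> carrier M" "b \<in> carrier M"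
      by (auto simp: groth_carrier)
    show "\<exists>y\<in>carrier (groth M). y \<otimes>\<^bsub>groth M\<^esub> x = \<one>\<^bsub>groth M\<^esub>"
    proof
      show "groth_class M b a \<in> carrier (groth M)"
        using ab by (auto simp: groth_carrier)
      show "groth_class M b a \<otimes>\<^bsub>groth M\<^esub> x = \<one>\<^bsub>groth M\<^esub>"
        using ab by (auto simp: one groth_mult[OF assms] groth_class_eq_iff[OF assms] m_ac)
    qed
  qed (auto simp: groth_carrier one groth_mult[OF assms] m_ac | blast)+
qed

lemma real_gmod_iff:
  assumes "group G"
  shows "real_gmod G V \<longleftrightarrow>
    (\<forall>g\<in>carrier G. snd V g \<in> carrier_mat (fst V) (fst V)) \<and>
    (\<forall>g\<in>carrier G. \<forall>h\<in>carrier G. snd V (g \<otimes>\<^bsub>G\<^esub> h) = snd V g * snd V h) \<and>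
    snd V \<one>\<^bsub>G\<^esub> = 1\<^sub>m (fst V)"
proof -
  interpret group G by fact
  let ?n = "fst V"
  let ?R = "ring_mat TYPE(real) ?n ()"
  interpret R: ring ?R by (rule ring_mat)
  have grp: "group (units_of ?R)"
    by (rule R.units_group)
  show ?thesis
  proof
    assume V: "real_gmod G V"
    then have h: "snd V \<in> hom G (units_of ?R)"
      by (simp add: real_gmod_def)
    then have "snd V \<one>\<^bsub>G\<^esub> = \<one>\<^bsub>units_of ?R\<^esub>"
      using hom_one[OF _ is_group grp] by blast
    then show "(\<forall>g\<in>carrier G. snd V g \<in> carrier_mat (fst V) (fst V)) \<and>
      (\<forall>g\<in>carrier G. \<forall>h\<in>carrier G. snd V (g \<otimes>\<^bsub>G\<^esub> h) = snd V g * snd V h) \<and>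
      snd V \<one>\<^bsub>G\<^esub> = 1\<^sub>m (fst V)"
      using h by (auto simp: hom_def units_of_def Units_def ring_mat_simps Pi_def)
  next
    assume r: "(\<forall>g\<in>carrier G. snd V g \<in> carrier_mat (fst V) (fst V)) \<and>
      (\<forall>g\<in>carrier G. \<forall>h\<in>carrier G. snd V (g \<otimes>\<^bsub>G\<^esub> h) = snd V g * snd V h) \<and>
      snd V \<one>\<^bsub>G\<^esub> = 1\<^sub>m (fst V)"
    have "snd V g \<in> Units ?R" if g: "g \<in> carrier G" for g
    proof -
      have "snd V (inv\<^bsub>G\<^esub> g) * snd V g = 1\<^sub>m ?n" "snd V g * snd V (inv\<^bsub>G\<^esub> g) = 1\<^sub>m ?n"
        using r g by (metis inv_closed l_inv, metis inv_closed r_inv)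
      then show ?thesis
        using r g unfolding Units_def ring_mat_simps
        by (auto intro!: bexI[of _ "snd V (inv\<^bsub>G\<^esub> g)"])
    qed
    then show "real_gmod G V"
      using r by (auto simp: real_gmod_def hom_def units_of_def ring_mat_simps)
  qed
qed

lemma real_gmod_carrier:
  assumes "group G" "real_gmod G V" "g \<in> carrier G"
  shows "snd V g \<in> carrier_mat (fst V) (fst V)"
  using assms by (simp add: real_gmod_iff)

lemma real_gmod_sum:
  assumes "group G" "real_gmod G U" "real_gmod G V"
  shows "real_gmod G (U \<oplus>\<^sub>m V)"
proof -
  interpret group G by fact
  let ?n = "fst U" and ?m = "fst V"
  note U = assms(2)[unfolded real_gmod_iff[OF assms(1)]]
  note V = assms(3)[unfolded real_gmod_iff[OF assms(1)]]
  have m: "four_block_mat (snd U g * snd U h) (0\<^sub>m ?n ?m) (0\<^sub>m ?m ?n) (snd V g * snd V h)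
    = four_block_mat (snd U g) (0\<^sub>m ?n ?m) (0\<^sub>m ?m ?n) (snd V g) *
      four_block_mat (snd U h) (0\<^sub>m ?n ?m) (0\<^sub>m ?m ?n) (snd V h)"
    if "g \<in> carrier G" "h \<in> carrier G" for g h
  proof -
    have c: "snd U g \<in> carrier_mat ?n ?n" "snd U h \<in> carrier_mat ?n ?n"
      "snd V g \<in> carrier_mat ?m ?m" "snd V h \<in> carrier_mat ?m ?m"
      using U V that by auto
    show ?thesis
      by (subst mult_four_block_mat[of _ ?n ?n _ ?m _ ?m _ _ ?n _ ?m]) (use c in auto)
  qed
  show ?thesis
    unfolding real_gmod_iff[OF assms(1)] gmod_sum_def fst_conv snd_conv
    using U V m by auto
qed

lemma real_gmod_zero: "group G \<Longrightarrow> real_gmod G gmod_zero"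
  by (auto simp: real_gmod_iff gmod_zero_def)

lemma gmod_iso_eqI:
  assumes "fst U = fst V" "\<And>h. h \<in> H \<Longrightarrow> snd U h = snd V h"
    "\<And>h. h \<in> H \<Longrightarrow> snd V h \<in> carrier_mat (fst V) (fst V)"
  shows "gmod_iso H U V"
proof -
  have "1\<^sub>m (fst V) * snd U h = snd V h * 1\<^sub>m (fst V)" if "h \<in> H" for h
    using assms(2,3)[OF that] by simp
  then show ?thesis
    unfolding gmod_iso_def
    by (intro bexI[of _ "1\<^sub>m (fst V)"]) (auto simp: assms(1))
qed

lemma gmod_iso_sym:
  assumes "gmod_iso H U V"
    "\<And>h. h \<in> H \<Longrightarrow> snd U h \<in> carrier_mat (fst U) (fst U)"
    "\<And>h. h \<in> H \<Longrightarrow> snd V h \<in> carrier_mat (fst V) (fst V)"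
  shows "gmod_iso H V U"
proof -
  let ?n = "fst U" and ?m = "fst V"
  obtain T S where T: "T \<in> carrier_mat ?m ?n" and S: "S \<in> carrier_mat ?n ?m"
    and TS: "T * S = 1\<^sub>m ?m" and ST: "S * T = 1\<^sub>m ?n"
    and eq: "\<And>h. h \<in> H \<Longrightarrow> T * snd U h = snd V h * T"
    using assms(1) unfolding gmod_iso_def by blast
  have "S * snd V h = snd U h * S" if "h \<in> H" for h
  proof -
    note U = assms(2)[OF that] and V = assms(3)[OF that]
    have "S * snd V h = S * (snd V h * (T * S))"
      using S V by (simp add: TS)
    also have "\<dots> = S * ((snd V h * T) * S)"
      using S V T by simp
    also have "\<dots> = (S * T) * (snd U h * S)"
      unfolding eq[OF that, symmetric] using S U T by (simp add: assoc_mult_mat[of S ?n ?m T ?n "snd U h * S" ?m] assoc_mult_mat[of T ?m ?n "snd U h" ?n S ?m])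
    also have "\<dots> = snd U h * S"
      using S U by (simp add: ST)
    finally show ?thesis .
  qed
  then show ?thesis
    unfolding gmod_iso_def using T S TS ST by blast
qed

lemma gmod_iso_trans:
  assumes "gmod_iso H U V" "gmod_iso H V W"
    "\<And>h. h \<in> H \<Longrightarrow> snd U h \<in> carrier_mat (fst U) (fst U)"
    "\<And>h. h \<in> H \<Longrightarrow> snd V h \<in> carrier_mat (fst V) (fst V)"
    "\<And>h. h \<in> H \<Longrightarrow> snd W h \<in> carrier_mat (fst W) (fst W)"
  shows "gmod_iso H U W"
proof -
  let ?n = "fst U" and ?m = "fst V" and ?k = "fst W"
  obtain T S where T: "T \<in> carrier_mat ?m ?n" and S: "S \<in> carrier_mat ?n ?m"
    and TS: "T * S = 1\<^sub>m ?m" and ST: "S * T = 1\<^sub>m ?n"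
    and eq: "\<And>h. h \<in> H \<Longrightarrow> T * snd U h = snd V h * T"
    using assms(1) unfolding gmod_iso_def by blast
  obtain T' S' where T': "T' \<in> carrier_mat ?k ?m" and S': "S' \<in> carrier_mat ?m ?k"
    and TS': "T' * S' = 1\<^sub>m ?k" and ST': "S' * T' = 1\<^sub>m ?m"
    and eq': "\<And>h. h \<in> H \<Longrightarrow> T' * snd V h = snd W h * T'"
    using assms(2) unfolding gmod_iso_def by blast
  have 1: "(T' * T) * (S * S') = 1\<^sub>m ?k"
  proof -
    have "(T' * T) * (S * S') = T' * ((T * S) * S')"
      using T T' S S' by (simp add: assoc_mult_mat[of T' ?k ?m T ?n "S * S'" ?k] assoc_mult_mat[of T ?m ?n S ?m S' ?k])
    then show ?thesis using S' by (simp add: TS TS')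
  qed
  have 2: "(S * S') * (T' * T) = 1\<^sub>m ?n"
  proof -
    have "(S * S') * (T' * T) = S * ((S' * T') * T)"
      using T T' S S' by (simp add: assoc_mult_mat[of S ?n ?m S' ?k "T' * T" ?n] assoc_mult_mat[of S' ?m ?k T' ?m T ?n])
    then show ?thesis using T by (simp add: ST ST')
  qed
  have 3: "(T' * T) * snd U h = snd W h * (T' * T)" if "h \<in> H" for h
  proof -
    note c = assms(3)[OF that] assms(4)[OF that] assms(5)[OF that]
    have "(T' * T) * snd U h = T' * (T * snd U h)"
      using T T' c by simp
    also have "\<dots> = (T' * snd V h) * T"
      unfolding eq[OF that] using T T' c by simp
    also have "\<dots> = snd W h * (T' * T)"
      unfolding eq'[OF that] using T T' c by simp
    finally show ?thesis .
  qed
  show ?thesis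
    unfolding gmod_iso_def
    using T T' S S' 1 2 3 by (intro bexI[of _ "T' * T"] bexI[of _ "S * S'"]) auto
qed

lemma gmod_iso_sum:
  assumes "gmod_iso H U U'" "gmod_iso H V V'"
    "\<And>h. h \<in> H \<Longrightarrow> snd U h \<in> carrier_mat (fst U) (fst U)"
    "\<And>h. h \<in> H \<Longrightarrow> snd U' h \<in> carrier_mat (fst U') (fst U')"
    "\<And>h. h \<in> H \<Longrightarrow> snd V h \<in> carrier_mat (fst V) (fst V)"
    "\<And>h. h \<in> H \<Longrightarrow> snd V' h \<in> carrier_mat (fst V') (fst V')"
  shows "gmod_iso H (U \<oplus>\<^sub>m V) (U' \<oplus>\<^sub>m V')"
proof -
  let ?n = "fst U" and ?n' = "fst U'" and ?m = "fst V" and ?m' = "fst V'"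
  obtain T S where T: "T \<in> carrier_mat ?n' ?n" and S: "S \<in> carrier_mat ?n ?n'"
    and TS: "T * S = 1\<^sub>m ?n'" and ST: "S * T = 1\<^sub>m ?n"
    and eq: "\<And>h. h \<in> H \<Longrightarrow> T * snd U h = snd U' h * T"
    using assms(1) unfolding gmod_iso_def by blast
  obtain T' S' where T': "T' \<in> carrier_mat ?m' ?m" and S': "S' \<in> carrier_mat ?m ?m'"
    and TS': "T' * S' = 1\<^sub>m ?m'" and ST': "S' * T' = 1\<^sub>m ?m"
    and eq': "\<And>h. h \<in> H \<Longrightarrow> T' * snd V h = snd V' h * T'"
    using assms(2) unfolding gmod_iso_def by blast
  let ?A = "four_block_mat T (0\<^sub>m ?n' ?m) (0\<^sub>m ?m' ?n) T'"
  let ?B = "four_block_mat S (0\<^sub>m ?n ?m') (0\<^sub>m ?m ?n') S'"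
  have 1: "?A * ?B = 1\<^sub>m (?n' + ?m')"
    by (subst mult_four_block_mat[of _ ?n' ?n _ ?m _ ?m' _ _ ?n' _ ?m'])
      (use T S T' S' in \<open>auto simp: TS TS'\<close>)
  have 2: "?B * ?A = 1\<^sub>m (?n + ?m)"
    by (subst mult_four_block_mat[of _ ?n ?n' _ ?m' _ ?m _ _ ?n _ ?m])
      (use T S T' S' in \<open>auto simp: ST ST'\<close>)
  have 3: "?A * snd (U \<oplus>\<^sub>m V) h = snd (U' \<oplus>\<^sub>m V') h * ?A" if "h \<in> H" for h
  proof -
    note c = assms(3)[OF that] assms(4)[OF that] assms(5)[OF that] assms(6)[OF that]
    have "?A * snd (U \<oplus>\<^sub>m V) h
        = four_block_mat (T * snd U h) (0\<^sub>m ?n' ?m) (0\<^sub>m ?m' ?n) (T' * snd V h)"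
      unfolding gmod_sum_def snd_conv
      by (subst mult_four_block_mat[of _ ?n' ?n _ ?m _ ?m' _ _ ?n _ ?m]) (use T T' c in auto)
    also have "\<dots> = snd (U' \<oplus>\<^sub>m V') h * ?A"
      unfolding gmod_sum_def snd_conv
      by (subst mult_four_block_mat[of _ ?n' ?n' _ ?m' _ ?m' _ _ ?n _ ?m])
        (use T T' c in \<open>auto simp: eq[OF that] eq'[OF that]\<close>)
    finally show ?thesis .
  qed
  have "?A \<in> carrier_mat (?n' + ?m') (?n + ?m)" "?B \<in> carrier_mat (?n + ?m) (?n' + ?m')"
    using T T' S S' by auto
  with 1 2 3 show ?thesis
    unfolding gmod_iso_def
    by (intro bexI[of _ ?A] bexI[of _ ?B]) (auto simp: gmod_sum_def)
qed

lemma gmod_iso_sum_comm: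
  assumes "\<And>h. h \<in> H \<Longrightarrow> snd U h \<in> carrier_mat (fst U) (fst U)"
    "\<And>h. h \<in> H \<Longrightarrow> snd V h \<in> carrier_mat (fst V) (fst V)"
  shows "gmod_iso H (U \<oplus>\<^sub>m V) (V \<oplus>\<^sub>m U)"
proof -
  let ?n = "fst U" and ?m = "fst V"
  define A where "A n m = four_block_mat (0\<^sub>m m n) (1\<^sub>m m) (1\<^sub>m n) (0\<^sub>m n m :: real mat)" for n m
  have 1: "A n m * A m n = 1\<^sub>m (m + n)" for n m
    unfolding A_def by (subst mult_four_block_mat[of _ m n _ m _ n _ _ m _ n]) auto
  have 2: "A ?n ?m * snd (U \<oplus>\<^sub>m V) h = snd (V \<oplus>\<^sub>m U) h * A ?n ?m" if "h \<in> H" for h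
  proof -
    note c = assms(1)[OF that] assms(2)[OF that]
    have "A ?n ?m * snd (U \<oplus>\<^sub>m V) h
        = four_block_mat (0\<^sub>m ?m ?n) (snd V h) (snd U h) (0\<^sub>m ?n ?m)"
      unfolding gmod_sum_def snd_conv A_def
      by (subst mult_four_block_mat[of _ ?m ?n _ ?m _ ?n _ _ ?n _ ?m]) (use c in auto)
    also have "\<dots> = snd (V \<oplus>\<^sub>m U) h * A ?n ?m"
      unfolding gmod_sum_def snd_conv A_def
      by (subst mult_four_block_mat[of _ ?m ?m _ ?n _ ?n _ _ ?n _ ?m]) (use c in auto)
    finally show ?thesis .
  qed
  have "A n m \<in> carrier_mat (m + n) (n + m)" for n m
    unfolding A_def by (rule four_block_carrier_mat) auto
  with 1 2 show ?thesis
    unfolding gmod_iso_def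
    by (intro bexI[of _ "A ?n ?m"] bexI[of _ "A ?m ?n"]) (auto simp: gmod_sum_def)
qed

lemma gmod_iso_sum_assoc:
  assumes "\<And>h. h \<in> H \<Longrightarrow> snd U h \<in> carrier_mat (fst U) (fst U)"
    "\<And>h. h \<in> H \<Longrightarrow> snd V h \<in> carrier_mat (fst V) (fst V)"
    "\<And>h. h \<in> H \<Longrightarrow> snd W h \<in> carrier_mat (fst W) (fst W)"
  shows "gmod_iso H (U \<oplus>\<^sub>m V \<oplus>\<^sub>m W) (U \<oplus>\<^sub>m (V \<oplus>\<^sub>m W))"
proof (rule gmod_iso_eqI)
  fix h assume h: "h \<in> H"
  note c = assms(1)[OF h] assms(2)[OF h] assms(3)[OF h]
  show "snd (U \<oplus>\<^sub>m V \<oplus>\<^sub>m W) h = snd (U \<oplus>\<^sub>m (V \<oplus>\<^sub>m W)) h"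
    using assoc_four_block_mat[of "snd U h" "snd V h" "snd W h"] c
    by (simp add: gmod_sum_def)
  show "snd (U \<oplus>\<^sub>m (V \<oplus>\<^sub>m W)) h
      \<in> carrier_mat (fst (U \<oplus>\<^sub>m (V \<oplus>\<^sub>m W))) (fst (U \<oplus>\<^sub>m (V \<oplus>\<^sub>m W)))"
    using c by (simp add: gmod_sum_def)
qed (simp add: gmod_sum_def)

lemma gmod_iso_sum_zero:
  assumes "\<And>h. h \<in> H \<Longrightarrow> snd U h \<in> carrier_mat (fst U) (fst U)"
  shows "gmod_iso H (gmod_zero \<oplus>\<^sub>m U) U"
proof (rule gmod_iso_eqI)
  fix h assume "h \<in> H"
  with assms have c: "snd U h \<in> carrier_mat (fst U) (fst U)" .
  then show "snd (gmod_zero \<oplus>\<^sub>m U) h = snd U h"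
    by (intro eq_matI) (auto simp: gmod_sum_def gmod_zero_def)
  show "snd U h \<in> carrier_mat (fst U) (fst U)" by (rule c)
qed (simp add: gmod_sum_def gmod_zero_def)

lemma fixed_dim_eq_0_iff:
  assumes "\<And>h. h \<in> H \<Longrightarrow> snd V h \<in> carrier_mat (fst V) (fst V)"
  shows "fixed_dim H V = 0 \<longleftrightarrow> fixed_space H V = {0\<^sub>v (fst V)}"
proof -
  let ?n = "fst V" and ?W = "fixed_space H V"
  interpret vs: vec_space "TYPE(real)" ?n .
  have zero: "A *\<^sub>v 0\<^sub>v n = 0\<^sub>v n" if "A \<in> carrier_mat n n" for A :: "real mat" and n
    using that by (intro eq_vecI) (auto simp: scalar_prod_def)
  have sub: "submodule class_ring ?W (module_vec TYPE(real) ?n)"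
  proof (rule submodule.intro)
    show "module class_ring (module_vec TYPE(real) ?n)" ..
    show "?W \<subseteq> carrier (module_vec TYPE(real) ?n)"
      by (auto simp: fixed_space_def)
    show "v \<oplus>\<^bsub>module_vec TYPE(real) ?n\<^esub> w \<in> ?W" if "v \<in> ?W" "w \<in> ?W" for v w
      using that mult_add_distrib_mat_vec[OF assms, of _ v w]
      by (auto simp: fixed_space_def module_vec_simps)
    show "\<zero>\<^bsub>module_vec TYPE(real) ?n\<^esub> \<in> ?W"
      using zero[OF assms] by (auto simp: fixed_space_def module_vec_simps)
    show "c \<odot>\<^bsub>module_vec TYPE(real) ?n\<^esub> v \<in> ?W" if "v \<in> ?W" for c v
      using that mult_mat_vec[OF assms, of _ v c]
      by (auto simp: fixed_space_def module_vec_simps)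
  qed
  then have subs: "subspace class_ring ?W (module_vec TYPE(real) ?n)"
    by (simp add: subspace_def vs.vectorspace_axioms)
  interpret W: vectorspace class_ring "vs.vs ?W"
    by (rule vs.subspace_is_vs[OF subs])
  have WV: "?W \<subseteq> carrier_vec ?n"
    by (auto simp: fixed_space_def)
  have bound: "finite A \<and> card A \<le> vs.dim" if "A \<subseteq> ?W \<and> W.lin_indpt A" for A
  proof -
    have "vs.lin_indpt A"
      using vs.span_li_not_depend(2)[OF _ sub, of A] that by simp
    then show ?thesis
      using vs.li_le_dim[OF vs.fin_dim, of A] that WV by auto
  qed
  have "W.lin_indpt {}"
    by (simp add: W.lin_dep_def)
  then obtain B where B: "finite B" "maximal B (\<lambda>S. S \<subseteq> ?W \<and> W.lin_indpt S)"
    using maximal_exists[of "\<lambda>S. S \<subseteq> ?W \<and> W.lin_indpt S" "vs.dim" "{}"] bound by blast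
  then have gB: "B \<subseteq> ?W" "W.span B = ?W" "W.lin_indpt B"
    using W.max_li_is_gen[of B] by (auto simp: maximal_def)
  then have basis: "W.basis B"
    by (simp add: W.basis_def)
  have dim: "fixed_dim H V = card B"
    unfolding fixed_dim_def using W.dim_basis[OF B(1) basis] .
  have span_empty: "W.span {} = {0\<^sub>v ?n}"
    by (simp add: W.span_empty module_vec_simps)
  show ?thesis
  proof
    assume "fixed_dim H V = 0"
    then have "B = {}" using dim B(1) by simp
    then show "?W = {0\<^sub>v ?n}" using gB(2) span_empty by simp
  next
    assume "?W = {0\<^sub>v ?n}"
    moreover have "0\<^sub>v ?n \<notin> B"
      using W.vs_zero_lin_dep[of B] gB by (simp add: module_vec_simps)
    ultimately have "B = {}" using gB(1) by auto
    then show "fixed_dim H V = 0" using dim by simp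
  qed
qed

lemma large_free_sum:
  assumes "group G" "real_gmod G U" "real_gmod G V" "large_free G U" "large_free G V"
  shows "large_free G (U \<oplus>\<^sub>m V)"
  unfolding large_free_def
proof (intro allI impI)
  fix H assume H: "large_subgroup G H"
  then have HG: "H \<subseteq> carrier G"
    by (auto simp: large_subgroup_def dest: subgroup.subset)
  let ?n = "fst U" and ?m = "fst V"
  have c: "snd U h \<in> carrier_mat ?n ?n" "snd V h \<in> carrier_mat ?m ?m" if "h \<in> H" for h
    using real_gmod_carrier[OF assms(1)] assms HG that by auto
  have s: "snd (U \<oplus>\<^sub>m V) h \<in> carrier_mat (fst (U \<oplus>\<^sub>m V)) (fst (U \<oplus>\<^sub>m V))" if "h \<in> H" for h
    using real_gmod_carrier[OF assms(1) real_gmod_sum[OF assms(1-3)]] HG that by auto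
  have U0: "fixed_space H U = {0\<^sub>v ?n}" and V0: "fixed_space H V = {0\<^sub>v ?m}"
    using assms(4,5) H fixed_dim_eq_0_iff[of H U, OF c(1)] fixed_dim_eq_0_iff[of H V, OF c(2)]
    by (simp_all add: large_free_def)
  have "fixed_space H (U \<oplus>\<^sub>m V) = {0\<^sub>v (?n + ?m)}"
  proof (intro equalityI subsetI)
    fix v assume v: "v \<in> fixed_space H (U \<oplus>\<^sub>m V)"
    define a b where "a = vec_first v ?n" and "b = vec_last v ?m"
    have ab: "a \<in> carrier_vec ?n" "b \<in> carrier_vec ?m" "v = a @\<^sub>v b"
      using v by (auto simp: a_def b_def fixed_space_def gmod_sum_def)
    have "snd U h *\<^sub>v a = a \<and> snd V h *\<^sub>v b = b" if "h \<in> H" for h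
    proof -
      have "snd (U \<oplus>\<^sub>m V) h *\<^sub>v (a @\<^sub>v b) = (snd U h *\<^sub>v a) @\<^sub>v (snd V h *\<^sub>v b)"
        unfolding gmod_sum_def snd_conv
        by (subst four_block_mat_mult_vec[of _ ?n ?n _ ?m _ ?m]) (use c[OF that] ab in auto)
      moreover have "snd (U \<oplus>\<^sub>m V) h *\<^sub>v (a @\<^sub>v b) = a @\<^sub>v b"
        using v that ab by (simp add: fixed_space_def)
      ultimately show ?thesis
        using append_vec_eq[of "snd U h *\<^sub>v a" ?n a] c[OF that] ab by auto
    qed
    then have "a \<in> fixed_space H U" "b \<in> fixed_space H V"
      using ab by (auto simp: fixed_space_def)
    then show "v \<in> {0\<^sub>v (?n + ?m)}"
      using U0 V0 ab by auto
  next
    fix v assume "v \<in> {0\<^sub>v (?n + ?m) :: real vec}"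
    moreover have "snd (U \<oplus>\<^sub>m V) h *\<^sub>v 0\<^sub>v (?n + ?m) = 0\<^sub>v (?n + ?m)" if "h \<in> H" for h
      using s[OF that] by (intro eq_vecI) (auto simp: scalar_prod_def gmod_sum_def)
    ultimately show "v \<in> fixed_space H (U \<oplus>\<^sub>m V)"
      by (auto simp: fixed_space_def gmod_sum_def)
  qed
  then show "fixed_dim H (U \<oplus>\<^sub>m V) = 0"
    using fixed_dim_eq_0_iff[of H "U \<oplus>\<^sub>m V"] s by (simp add: gmod_sum_def)
qed

lemma large_free_zero: "large_free G gmod_zero"
  unfolding large_free_def
proof (intro allI impI)
  fix H :: "'a set"
  have "fixed_space H gmod_zero = {0\<^sub>v 0}"
    by (auto simp: fixed_space_def gmod_zero_def)
  then show "fixed_dim H gmod_zero = 0"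
    by (subst fixed_dim_eq_0_iff) (auto simp: gmod_zero_def)
qed

lemma equiv_gmod_rel:
  assumes "group G"
  shows "equiv (Collect (real_gmod G)) (gmod_rel G)"
proof (rule equivI)
  note c = real_gmod_carrier[OF assms]
  show "gmod_rel G \<subseteq> Collect (real_gmod G) \<times> Collect (real_gmod G)"
    by (auto simp: gmod_rel_def)
  show "refl_on (Collect (real_gmod G)) (gmod_rel G)"
    using c by (auto simp: refl_on_def gmod_rel_def intro!: gmod_iso_eqI)
  show "sym (gmod_rel G)"
  proof (rule symI)
    fix U V assume "(U, V) \<in> gmod_rel G"
    then have *: "real_gmod G U" "real_gmod G V" "gmod_iso (carrier G) U V"
      by (simp_all add: gmod_rel_def)
    then have "gmod_iso (carrier G) V U"
      using gmod_iso_sym[OF *(3)] c by blast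
    with * show "(V, U) \<in> gmod_rel G"
      by (simp add: gmod_rel_def)
  qed
  show "trans (gmod_rel G)"
  proof (rule transI)
    fix U V W assume "(U, V) \<in> gmod_rel G" "(V, W) \<in> gmod_rel G"
    then have *: "real_gmod G U" "real_gmod G V" "real_gmod G W"
      "gmod_iso (carrier G) U V" "gmod_iso (carrier G) V W"
      by (simp_all add: gmod_rel_def)
    then have "gmod_iso (carrier G) U W"
      using gmod_iso_trans[OF *(4,5)] c by blast
    with * show "(U, W) \<in> gmod_rel G"
      by (simp add: gmod_rel_def)
  qed
qed

lemma gmod_class_eq_iff:
  assumes "group G" "real_gmod G U" "real_gmod G V"
  shows "gmod_class G U = gmod_class G V \<longleftrightarrow> gmod_iso (carrier G) U V"
  unfolding gmod_class_def
  using eq_equiv_class_iff[OF equiv_gmod_rel[OF assms(1)], of U V] assms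
  by (auto simp: gmod_rel_def)

lemma gmod_monoid_carrier: "carrier (gmod_monoid G) = gmod_class G ` Collect (real_gmod G)"
  by (auto simp: gmod_monoid_def gmod_class_def quotient_def)

lemma gmod_monoid_mult:
  assumes "group G" "real_gmod G U" "real_gmod G V"
  shows "gmod_class G U \<otimes>\<^bsub>gmod_monoid G\<^esub> gmod_class G V = gmod_class G (U \<oplus>\<^sub>m V)"
proof -
  note c = real_gmod_carrier[OF assms(1)]
  have *: "gmod_class G (U' \<oplus>\<^sub>m V') = gmod_class G (U \<oplus>\<^sub>m V)"
    if "U' \<in> gmod_class G U" "V' \<in> gmod_class G V" for U' V'
  proof -
    have 1: "real_gmod G U'" "real_gmod G V'" "gmod_iso (carrier G) U U'" "gmod_iso (carrier G) V V'"
      using that by (auto simp: gmod_class_def gmod_rel_def)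
    then have "gmod_iso (carrier G) (U \<oplus>\<^sub>m V) (U' \<oplus>\<^sub>m V')"
      using assms c by (intro gmod_iso_sum) auto
    then show ?thesis
      using gmod_class_eq_iff[OF assms(1) real_gmod_sum[OF assms] real_gmod_sum[OF assms(1) 1(1,2)]]
      by simp
  qed
  have mem: "U \<in> gmod_class G U" "V \<in> gmod_class G V"
    using equiv_class_self[OF equiv_gmod_rel[OF assms(1)]] assms by (auto simp: gmod_class_def)
  have "gmod_class G U \<otimes>\<^bsub>gmod_monoid G\<^esub> gmod_class G V
      = (\<Union>U'\<in>gmod_class G U. \<Union>V'\<in>gmod_class G V. gmod_class G (U' \<oplus>\<^sub>m V'))"
    by (simp add: gmod_monoid_def)
  also have "\<dots> = (\<Union>U'\<in>gmod_class G U. \<Union>V'\<in>gmod_class G V. gmod_class G (U \<oplus>\<^sub>m V))"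
    by (intro SUP_cong refl) (simp add: *)
  also have "\<dots> = gmod_class G (U \<oplus>\<^sub>m V)"
    using mem by auto
  finally show ?thesis .
qed

lemma gmod_monoid_one: "\<one>\<^bsub>gmod_monoid G\<^esub> = gmod_class G gmod_zero"
  by (simp add: gmod_monoid_def)

lemma comm_monoid_gmod_monoid:
  assumes "group G"
  shows "comm_monoid (gmod_monoid G)"
proof -
  note c = real_gmod_carrier[OF assms]
  note s = real_gmod_sum[OF assms] real_gmod_zero[OF assms]
  note eq = gmod_class_eq_iff[OF assms]
  show ?thesis
  proof (rule comm_monoidI)
    fix x y z
    assume "x \<in> carrier (gmod_monoid G)" "y \<in> carrier (gmod_monoid G)"
      "z \<in> carrier (gmod_monoid G)"
    then obtain U V W where *: "x = gmod_class G U" "y = gmod_class G V" "z = gmod_class G W"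
      "real_gmod G U" "real_gmod G V" "real_gmod G W"
      by (auto simp: gmod_monoid_carrier)
    show "x \<otimes>\<^bsub>gmod_monoid G\<^esub> y \<otimes>\<^bsub>gmod_monoid G\<^esub> z = x \<otimes>\<^bsub>gmod_monoid G\<^esub> (y \<otimes>\<^bsub>gmod_monoid G\<^esub> z)"
      using * s eq c by (simp add: gmod_monoid_mult[OF assms] gmod_iso_sum_assoc)
  next
    fix x y
    assume "x \<in> carrier (gmod_monoid G)" "y \<in> carrier (gmod_monoid G)"
    then obtain U V where *: "x = gmod_class G U" "y = gmod_class G V"
      "real_gmod G U" "real_gmod G V"
      by (auto simp: gmod_monoid_carrier)
    show "x \<otimes>\<^bsub>gmod_monoid G\<^esub> y \<in> carrier (gmod_monoid G)"
      using * s by (auto simp: gmod_monoid_mult[OF assms] gmod_monoid_carrier)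
    show "x \<otimes>\<^bsub>gmod_monoid G\<^esub> y = y \<otimes>\<^bsub>gmod_monoid G\<^esub> x"
      using * s eq c by (simp add: gmod_monoid_mult[OF assms] gmod_iso_sum_comm)
  next
    fix x assume "x \<in> carrier (gmod_monoid G)"
    then obtain U where *: "x = gmod_class G U" "real_gmod G U"
      by (auto simp: gmod_monoid_carrier)
    show "\<one>\<^bsub>gmod_monoid G\<^esub> \<otimes>\<^bsub>gmod_monoid G\<^esub> x = x"
      using * s eq c by (simp add: gmod_monoid_one gmod_monoid_mult[OF assms] gmod_iso_sum_zero)
  qed (use s in \<open>auto simp: gmod_monoid_carrier gmod_monoid_one\<close>)
qed

theorem comm_group_RO: "group G \<Longrightarrow> comm_group (RO G)"
  unfolding RO_def by (intro comm_group_groth comm_monoid_gmod_monoid)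

lemma gmod_diff_eq_iff:
  assumes "group G" "real_gmod G U" "real_gmod G V" "real_gmod G U'" "real_gmod G V'"
  shows "gmod_diff G U V = gmod_diff G U' V' \<longleftrightarrow>
    (\<exists>W. real_gmod G W \<and> gmod_iso (carrier G) (U \<oplus>\<^sub>m V' \<oplus>\<^sub>m W) (U' \<oplus>\<^sub>m V \<oplus>\<^sub>m W))"
proof -
  note s = real_gmod_sum[OF assms(1)]
  have "gmod_diff G U V = gmod_diff G U' V' \<longleftrightarrow> (\<exists>W. real_gmod G W \<and>
      gmod_class G U \<otimes>\<^bsub>gmod_monoid G\<^esub> gmod_class G V' \<otimes>\<^bsub>gmod_monoid G\<^esub> gmod_class G W =
      gmod_class G U' \<otimes>\<^bsub>gmod_monoid G\<^esub> gmod_class G V \<otimes>\<^bsub>gmod_monoid G\<^esub> gmod_class G W)"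
    unfolding gmod_diff_def
    using assms
    by (subst groth_class_eq_iff[OF comm_monoid_gmod_monoid[OF assms(1)]])
      (auto simp: gmod_monoid_carrier)
  also have "\<dots> \<longleftrightarrow>
    (\<exists>W. real_gmod G W \<and> gmod_iso (carrier G) (U \<oplus>\<^sub>m V' \<oplus>\<^sub>m W) (U' \<oplus>\<^sub>m V \<oplus>\<^sub>m W))"
    using assms
    by (intro ex_cong1 conj_cong refl)
      (simp add: gmod_monoid_mult[OF assms(1)] s gmod_class_eq_iff[OF assms(1)])
  finally show ?thesis .
qed

lemma gmod_diff_mult:
  assumes "group G" "real_gmod G U" "real_gmod G V" "real_gmod G U'" "real_gmod G V'"
  shows "gmod_diff G U V \<otimes>\<^bsub>RO G\<^esub> gmod_diff G U' V' = gmod_diff G (U \<oplus>\<^sub>m U') (V \<oplus>\<^sub>m V')"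
  unfolding gmod_diff_def RO_def
  using assms
  by (subst groth_mult[OF comm_monoid_gmod_monoid[OF assms(1)]])
    (auto simp: gmod_monoid_carrier gmod_monoid_mult[OF assms(1)])

lemma RO_one: "\<one>\<^bsub>RO G\<^esub> = gmod_diff G gmod_zero gmod_zero"
  by (simp add: RO_def groth_def gmod_diff_def gmod_monoid_one)

theorem subgroup_LO:
  assumes "group G"
  shows "subgroup (LO G) (RO G)"
proof -
  interpret RO: comm_group "RO G" by (rule comm_group_RO[OF assms])
  note c = real_gmod_carrier[OF assms]
  note s = real_gmod_sum[OF assms] real_gmod_zero[OF assms]
  have cP: "snd U h \<in> carrier_mat (fst U) (fst U)"
    if "real_gmod G U" "subgroup P G" "h \<in> P" for U P h
    using that c subgroup.subset by blast
  have sub: "LO G \<subseteq> carrier (RO G)"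
    unfolding LO_def RO_def groth_carrier gmod_diff_def gmod_monoid_carrier by blast
  have one: "\<one>\<^bsub>RO G\<^esub> \<in> LO G"
  proof -
    have "gmod_iso P gmod_zero gmod_zero" if "subgroup P G" for P
      using cP[OF s(2) that] by (intro gmod_iso_eqI) auto
    then show ?thesis
      unfolding LO_def RO_one using s(2) large_free_zero[of G] by blast
  qed
  have mult: "X \<otimes>\<^bsub>RO G\<^esub> Y \<in> LO G" if XY: "X \<in> LO G" "Y \<in> LO G" for X Y
  proof -
    obtain U V where X: "X = gmod_diff G U V" "real_gmod G U" "real_gmod G V" "large_free G U"
      "large_free G V" "\<forall>P. subgroup P G \<and> prime_power (card P) \<longrightarrow> gmod_iso P U V"
      using XY(1) unfolding LO_def by blast
    obtain U' V' where Y: "Y = gmod_diff G U' V'" "real_gmod G U'" "real_gmod G V'" "large_free G U'"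
      "large_free G V'" "\<forall>P. subgroup P G \<and> prime_power (card P) \<longrightarrow> gmod_iso P U' V'"
      using XY(2) unfolding LO_def by blast
    have "gmod_iso P (U \<oplus>\<^sub>m U') (V \<oplus>\<^sub>m V')" if "subgroup P G" "prime_power (card P)" for P
      using X Y that cP[of _ P] by (intro gmod_iso_sum) auto
    moreover have "large_free G (U \<oplus>\<^sub>m U')" "large_free G (V \<oplus>\<^sub>m V')"
      using X Y large_free_sum[OF assms] by auto
    ultimately show ?thesis
      unfolding LO_def using gmod_diff_mult[OF assms X(2,3) Y(2,3)] X Y s(1) by blast
  qed
  have inv: "inv\<^bsub>RO G\<^esub> X \<in> LO G" if XL: "X \<in> LO G" for X
  proof -
    obtain U V where X: "X = gmod_diff G U V" "real_gmod G U" "real_gmod G V" "large_free G U"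
      "large_free G V" "\<forall>P. subgroup P G \<and> prime_power (card P) \<longrightarrow> gmod_iso P U V"
      using XL unfolding LO_def by blast
    have "gmod_iso P V U" if "subgroup P G" "prime_power (card P)" for P
      using gmod_iso_sym[of P U V] X that cP by blast
    then have Y: "gmod_diff G V U \<in> LO G"
      unfolding LO_def using X by blast
    have "gmod_iso (carrier G) (V \<oplus>\<^sub>m U \<oplus>\<^sub>m gmod_zero \<oplus>\<^sub>m gmod_zero)
        (gmod_zero \<oplus>\<^sub>m (U \<oplus>\<^sub>m V) \<oplus>\<^sub>m gmod_zero)"
    proof -
      interpret M: comm_monoid "gmod_monoid G"
        by (rule comm_monoid_gmod_monoid[OF assms])
      let ?u = "gmod_class G U" and ?v = "gmod_class G V"
      have "?u \<in> carrier (gmod_monoid G)" "?v \<in> carrier (gmod_monoid G)"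
        using X by (auto simp: gmod_monoid_carrier)
      then have "?v \<otimes>\<^bsub>gmod_monoid G\<^esub> ?u \<otimes>\<^bsub>gmod_monoid G\<^esub> \<one>\<^bsub>gmod_monoid G\<^esub> \<otimes>\<^bsub>gmod_monoid G\<^esub> \<one>\<^bsub>gmod_monoid G\<^esub>
        = \<one>\<^bsub>gmod_monoid G\<^esub> \<otimes>\<^bsub>gmod_monoid G\<^esub> (?u \<otimes>\<^bsub>gmod_monoid G\<^esub> ?v) \<otimes>\<^bsub>gmod_monoid G\<^esub> \<one>\<^bsub>gmod_monoid G\<^esub>"
        by (simp add: M.m_comm)
      then show ?thesis
        unfolding gmod_monoid_one
        using X s gmod_class_eq_iff[OF assms] by (simp add: gmod_monoid_mult[OF assms])
    qed
    then have "gmod_diff G V U \<otimes>\<^bsub>RO G\<^esub> X = \<one>\<^bsub>RO G\<^esub>"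
      unfolding X(1) RO_one gmod_diff_mult[OF assms X(3,2,2,3)]
      using gmod_diff_eq_iff[OF assms s(1)[OF X(3,2)] s(1)[OF X(2,3)] s(2) s(2)] s(2) by blast
    then have "inv\<^bsub>RO G\<^esub> X = gmod_diff G V U"
      by (rule RO.inv_equality[OF _ subsetD[OF sub XL] subsetD[OF sub Y]])
    then show ?thesis
      using Y by simp
  qed
  show ?thesis
  proof (rule RO.subgroupI)
    show "LO G \<noteq> {}"
      using one by blast
  qed (fact sub inv mult)+
qed

end

(* A cyclic quotient of order pq gives a surjection e : G -> Z/pq. Choose k with k = 1 mod p and
   k = -1 mod q. The planar rotation representations through the angles 2 pi e/(pq) and
   2 pi k e/(pq) are large-free because e and k e are nonzero on every O^r(G). On a subgroup of
   prime power order e is divisible by p or by q, so there k e = - e or k e = e, and the two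
   modules agree up to a reflection; their characters differ where e = 1, since k is not +-1
   mod pq. Elements with e = 1 and e = 2 lie in different real conjugacy classes, as pq > 3. *)

theory Submission
  imports Defs "HOL-Number_Theory.Cong"
begin

section \<open>Homomorphisms from a group to the integers modulo n\<close>

text \<open>A homomorphism from \<open>G\<close> to \<open>\<int>/n\<close>, represented by integer-valued lifts.\<close>

definition hom_mod :: "('g, 'b) monoid_scheme \<Rightarrow> nat \<Rightarrow> ('g \<Rightarrow> int) \<Rightarrow> bool"
  where "hom_mod G n e \<longleftrightarrow>
    (\<forall>x\<in>carrier G. \<forall>y\<in>carrier G. [e (x \<otimes>\<^bsub>G\<^esub> y) = e x + e y] (mod int n))"

lemma hom_mod_mult:
  "hom_mod G n e \<Longrightarrow> x \<in> carrier G \<Longrightarrow> y \<in> carrier G \<Longrightarrow> [e (x \<otimes>\<^bsub>G\<^esub> y) = e x + e y] (mod int n)"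
  by (simp add: hom_mod_def)

lemma hom_mod_scale: "hom_mod G n e \<Longrightarrow> hom_mod G n (\<lambda>g. k * e g)"
  unfolding hom_mod_def by (metis cong_scalar_left distrib_left)

lemma hom_mod_one:
  assumes "group G" "hom_mod G n e"
  shows "[e \<one>\<^bsub>G\<^esub> = 0] (mod int n)"
proof -
  interpret group G by fact
  have "[e \<one>\<^bsub>G\<^esub> + 0 = e \<one>\<^bsub>G\<^esub> + e \<one>\<^bsub>G\<^esub>] (mod int n)"
    using hom_mod_mult[OF assms(2), of "\<one>\<^bsub>G\<^esub>" "\<one>\<^bsub>G\<^esub>"] by simp
  then show ?thesis
    using cong_add_lcancel cong_sym by blast
qed

lemma hom_mod_inv:
  assumes "group G" "hom_mod G n e" "x \<in> carrier G"
  shows "[e (inv\<^bsub>G\<^esub> x) = - e x] (mod int n)"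
proof -
  interpret group G by fact
  have "[e x + e (inv\<^bsub>G\<^esub> x) = e x + - e x] (mod int n)"
    using hom_mod_mult[OF assms(2), of x "inv\<^bsub>G\<^esub> x"] hom_mod_one[OF assms(1,2)] assms(3)
    by simp (metis cong_sym cong_trans)
  then show ?thesis
    by (simp only: cong_add_lcancel)
qed

lemma hom_mod_pow:
  assumes "group G" "hom_mod G n e" "x \<in> carrier G"
  shows "[e (x [^]\<^bsub>G\<^esub> (k::nat)) = int k * e x] (mod int n)"
proof -
  interpret group G by fact
  show ?thesis
  proof (induction k)
    case 0
    then show ?case using hom_mod_one[OF assms(1,2)] by simp
  next
    case (Suc k)
    have "[e (x [^]\<^bsub>G\<^esub> k \<otimes>\<^bsub>G\<^esub> x) = e (x [^]\<^bsub>G\<^esub> k) + e x] (mod int n)"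
      using assms(3) by (intro hom_mod_mult[OF assms(2)]) auto
    also have "[e (x [^]\<^bsub>G\<^esub> k) + e x = int k * e x + e x] (mod int n)"
      using Suc by (intro cong_add) auto
    finally show ?case
      by (simp add: algebra_simps)
  qed
qed

lemma hom_mod_conjugate:
  assumes "group G" "hom_mod G n e" "g \<in> carrier G" "conjugate G g h"
  shows "[e h = e g] (mod int n)"
proof -
  interpret group G by fact
  obtain x where x: "x \<in> carrier G" "h = x \<otimes>\<^bsub>G\<^esub> g \<otimes>\<^bsub>G\<^esub> inv\<^bsub>G\<^esub> x"
    using assms(4) unfolding conjugate_def by blast
  have "[e h = e (x \<otimes>\<^bsub>G\<^esub> g) + e (inv\<^bsub>G\<^esub> x)] (mod int n)"
    unfolding x(2) using x(1) assms(3) by (intro hom_mod_mult[OF assms(2)]) auto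
  also have "[e (x \<otimes>\<^bsub>G\<^esub> g) + e (inv\<^bsub>G\<^esub> x) = (e x + e g) + - e x] (mod int n)"
    using x(1) assms(3)
    by (intro cong_add hom_mod_mult[OF assms(2)] hom_mod_inv[OF assms(1,2)]) auto
  finally show ?thesis
    by simp
qed

text \<open>The target Z/n is abelian, so \<open>e\<close> is constant modulo \<open>n\<close> on
  conjugacy classes, and inversion changes its sign. Up to sign, \<open>e\<close> is therefore an
  invariant of real conjugacy classes.\<close>

lemma hom_mod_real_conj:
  assumes "group G" "hom_mod G n e" "(g, h) \<in> real_conj G"
  shows "[e h = e g] (mod int n) \<or> [e h = - e g] (mod int n)"
proof -
  interpret group G by fact
  show ?thesis
    using assms hom_mod_conjugate[OF assms(1,2), of g h]
      hom_mod_conjugate[OF assms(1,2), of "inv\<^bsub>G\<^esub> g" h] hom_mod_inv[OF assms(1,2), of g]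
    by (auto simp: real_conj_def intro: cong_trans)
qed

text \<open>The lift \<open>e\<close> is a discrete logarithm: \<open>e g\<close> is an exponent
  that expresses the coset of \<open>g\<close> as a power of a fixed generator \<open>X\<close>.
  Exponents are determined modulo the order of \<open>X\<close>, which is the order of the
  quotient.\<close>

lemma cyclic_quotient_hom_mod:
  assumes "N \<lhd> G" "cyclic_group (G Mod N)"
  obtains e c where "hom_mod G (Coset.order (G Mod N)) e" "c \<in> carrier G"
    "[e c = 1] (mod int (Coset.order (G Mod N)))"
proof -
  interpret normal N G by fact
  let ?Q = "G Mod N"
  interpret Q: group ?Q by (rule factorgroup_is_group)
  obtain X where X: "X \<in> carrier ?Q" and gen: "carrier ?Q = range (\<lambda>n::int. X [^]\<^bsub>?Q\<^esub> n)"
    using assms(2) Q.cyclic_group by blast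
  obtain c where c: "c \<in> carrier G" "X = N #>\<^bsub>G\<^esub> c"
    using X by (auto simp: FactGroup_def RCOSETS_def)
  have ord: "Coset.order ?Q = Q.ord X"
    using Q.generate_pow_card[OF X] gen Q.generate_pow[OF X]
    by (simp add: Coset.order_def full_SetCompr_eq)
  have mem: "N #>\<^bsub>G\<^esub> g \<in> carrier ?Q" if "g \<in> carrier G" for g
    using that by (auto simp: FactGroup_def RCOSETS_def)
  \<comment> \<open>An arbitrary exponent is chosen for each \<open>g\<close>, so \<open>e\<close>
    is additive only modulo the order of the quotient, which is all that \<open>hom_mod\<close>
    asks.\<close>
  define e :: "'a \<Rightarrow> int" where "e g = (SOME m. N #>\<^bsub>G\<^esub> g = X [^]\<^bsub>?Q\<^esub> m)" for g
  have e: "N #>\<^bsub>G\<^esub> g = X [^]\<^bsub>?Q\<^esub> e g" if "g \<in> carrier G" for g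
    unfolding e_def by (rule someI_ex) (use mem[OF that] in \<open>simp add: gen image_iff\<close>)
  have eqI: "[m = l] (mod int (Coset.order ?Q))" if "X [^]\<^bsub>?Q\<^esub> m = X [^]\<^bsub>?Q\<^esub> l" for m l :: int
    using that Q.int_pow_eq[OF X, of m l] by (subst cong_sym_eq) (simp add: ord cong_iff_dvd_diff)
  show ?thesis
  proof (rule that[OF _ c(1)])
    show "hom_mod G (Coset.order ?Q) e"
      unfolding hom_mod_def
    proof (intro ballI eqI)
      fix x y assume xy: "x \<in> carrier G" "y \<in> carrier G"
      have "X [^]\<^bsub>?Q\<^esub> e (x \<otimes>\<^bsub>G\<^esub> y) = (N #>\<^bsub>G\<^esub> x) \<otimes>\<^bsub>?Q\<^esub> (N #>\<^bsub>G\<^esub> y)"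
        using xy e[of "x \<otimes>\<^bsub>G\<^esub> y"] by (simp add: FactGroup_def rcos_sum)
      also have "\<dots> = X [^]\<^bsub>?Q\<^esub> (e x + e y)"
        using xy e X by (simp add: Q.int_pow_mult)
      finally show "X [^]\<^bsub>?Q\<^esub> e (x \<otimes>\<^bsub>G\<^esub> y) = X [^]\<^bsub>?Q\<^esub> (e x + e y)" .
    qed
    show "[e c = 1] (mod int (Coset.order ?Q))"
      using e[OF c(1)] X by (intro eqI) (simp add: c(2))
  qed
qed

section \<open>Elements of non-prime-power order and the Laitinen number\<close>

text \<open>The only prime that can divide \<open>m\<close> differs from at least one of
  \<open>p\<close> and \<open>q\<close>. That one is coprime to \<open>m\<close>, so it must divide
  \<open>a\<close>.\<close>

lemma prime_power_dvd_coprime: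
  fixes p q :: nat
  assumes "prime p" "prime q" "p \<noteq> q" "prime_power m" "int (p * q) dvd int m * a"
  shows "int p dvd a \<or> int q dvd a"
proof -
  obtain r k where r: "prime r" "m = r ^ k"
    using assms(4) unfolding prime_power_def by blast
  have *: "int s dvd a" if "prime s" "s \<noteq> r" "int s dvd int m * a" for s
  proof -
    have "coprime s m"
      using that r primes_coprime[of s r] by simp
    then show ?thesis
      using that(3) by (simp add: coprime_dvd_mult_right_iff)
  qed
  have "int p dvd int m * a" "int q dvd int m * a"
    using assms(5) by (auto elim: dvd_trans[rotated])
  then show ?thesis
    using *[OF assms(1)] *[OF assms(2)] assms(3) by blast
qed

text \<open>Applying \<open>e\<close> to \<open>g\<close> raised to its order shows that
  \<open>p * q\<close> divides \<open>ord g * e g\<close>, so a prime power order would force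
  \<open>p\<close> or \<open>q\<close> to divide \<open>e g\<close>.\<close>

lemma not_prime_power_ord:
  assumes "group G" "hom_mod G (p * q) e" "prime p" "prime q" "p \<noteq> q" "g \<in> carrier G"
    and "\<not> int p dvd e g" "\<not> int q dvd e g"
  shows "\<not> prime_power (group.ord G g)"
proof
  interpret group G by fact
  assume "prime_power (ord g)"
  moreover have "[int (ord g) * e g = 0] (mod int (p * q))"
    using hom_mod_pow[OF assms(1,2,6), of "ord g"] hom_mod_one[OF assms(1,2)] assms(6)
    by (simp add: pow_ord_eq_1) (metis cong_sym cong_trans)
  ultimately show False
    using prime_power_dvd_coprime[of p q "ord g" "e g"] assms by (simp add: cong_0_iff)
qed

lemma laitinen_number_ge_2:
  assumes "group G" "finite (carrier G)"
    and "g \<in> carrier G" "h \<in> carrier G" "\<not> prime_power (group.ord G g)"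
    and "\<not> prime_power (group.ord G h)" "(g, h) \<notin> real_conj G"
  shows "laitinen_number G \<ge> 2"
proof -
  let ?S = "{g \<in> carrier G. \<not> prime_power (group.ord G g)}" and ?R = "real_conj G"
  have "?S // ?R = (\<lambda>x. ?R `` {x}) ` ?S"
    by (auto simp: quotient_def)
  \<comment> \<open>Finiteness matters here: \<open>card\<close> of an infinite set is 0, and
    \<open>card_mono\<close> would not apply.\<close>
  then have "finite (?S // ?R)"
    using assms(2) by simp
  moreover have "{?R `` {g}, ?R `` {h}} \<subseteq> ?S // ?R"
    using assms by (auto intro: quotientI)
  ultimately have "card {?R `` {g}, ?R `` {h}} \<le> laitinen_number G"
    unfolding laitinen_number_def by (rule card_mono)
  moreover have "?R `` {g} \<noteq> ?R `` {h}"
    using eq_equiv_class_iff[OF equiv_real_conj[OF assms(1)] assms(3,4)] assms(7) by simp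
  ultimately show ?thesis
    by simp
qed

section \<open>Rotation modules of the plane\<close>

definition rotation :: "real \<Rightarrow> real mat"
  where "rotation t = mat 2 2 (\<lambda>(i, j). if i = j then cos t else if i = 0 then - sin t else sin t)"

lemma rotation_carrier [simp]: "rotation t \<in> carrier_mat 2 2"
  by (simp add: rotation_def)

lemma less_2_iff: "(i::nat) < 2 \<longleftrightarrow> i = 0 \<or> i = 1"
  by auto

lemma rotation_add: "rotation (s + t) = rotation s * rotation t"
  by (rule eq_matI)
    (auto simp: rotation_def less_2_iff scalar_prod_def sum.atLeast_Suc_lessThan numeral_2_eq_2
      cos_add sin_add)

lemma rotation_zero: "rotation 0 = 1\<^sub>m 2"
  by (rule eq_matI) (auto simp: rotation_def)

text \<open>This is the realification of the one-dimensional complex character that sends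
  \<open>g\<close> to exp(2 pi i e(g)/n).\<close>

definition rotation_module :: "nat \<Rightarrow> ('g \<Rightarrow> int) \<Rightarrow> 'g gmod"
  where "rotation_module n e = (2, \<lambda>g. rotation (2 * pi * real_of_int (e g) / real n))"

lemma angle_eq:
  assumes "n > 0" "[a = b] (mod int n)"
  obtains k :: int
  where "2 * pi * real_of_int a / real n = 2 * pi * real_of_int b / real n + 2 * pi * k"
proof -
  obtain k where "a - b = int n * k"
    using assms(2) by (auto simp: cong_iff_dvd_diff)
  then have "real_of_int a = real_of_int b + real n * real_of_int k"
    by (metis add.commute diff_add_cancel of_int_add of_int_mult of_int_of_nat_eq)
  then have "2 * pi * real_of_int a / real n = 2 * pi * real_of_int b / real n + 2 * pi * k"
    using assms(1) by (simp add: field_simps)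
  then show ?thesis ..
qed

text \<open>Another lift of the same residue changes the angle by a multiple of 2 pi. Hence the
  rotation depends on the residue class alone, and lifts that are additive only modulo
  \<open>n\<close> still give a representation.\<close>

lemma rotation_cong:
  assumes "n > 0" "[a = b] (mod int n)"
  shows "rotation (2 * pi * real_of_int a / real n) = rotation (2 * pi * real_of_int b / real n)"
proof -
  obtain k :: int where
    "2 * pi * real_of_int a / real n = 2 * pi * real_of_int b / real n + 2 * pi * k"
    using angle_eq[OF assms] by blast
  then have "sin (2 * pi * real_of_int a / real n) = sin (2 * pi * real_of_int b / real n)
    \<and> cos (2 * pi * real_of_int a / real n) = cos (2 * pi * real_of_int b / real n)"
    using sin_cos_eq_iff by blast
  then show ?thesis
    by (simp only: rotation_def)
qed

text \<open>A cosine determines its angle up to sign and multiples of 2 pi. This is the converse of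
  \<open>rotation_cong\<close>, up to the sign that a reflection can absorb.\<close>

lemma cos_eq_cong:
  fixes a b :: int
  assumes "n > 0" "cos (2 * pi * a / real n) = cos (2 * pi * b / real n)"
  shows "[a = b] (mod int n) \<or> [a = - b] (mod int n)"
proof -
  let ?x = "2 * pi * a / real n" and ?y = "2 * pi * b / real n"
  have *: "[u = v] (mod int n)" if k: "2 * pi * u / real n = 2 * pi * v / real n + 2 * pi * k"
    for u v k :: int
  proof -
    have "2 * pi * u = 2 * pi * (v + real n * k)"
      using k assms(1) by (simp add: field_simps)
    then have "real_of_int u = real_of_int (v + int n * k)"
      by (simp del: of_int_eq_iff)
    then have "u = v + int n * k"
      by (simp only: of_int_eq_iff)
    then show ?thesis
      by (simp add: cong_iff_dvd_diff)
  qed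
  \<comment> \<open>Equal cosines leave two choices for the sine; the negative one is the sine at
    \<open>- b\<close>.\<close>
  have "(sin ?x)\<^sup>2 = (sin ?y)\<^sup>2"
    using assms(2) by (simp add: sin_squared_eq)
  then consider "sin ?x = sin ?y" | "sin ?x = - sin ?y"
    by (auto simp: power2_eq_iff)
  then show ?thesis
  proof cases
    case 1
    then show ?thesis
      using assms(2) sin_cos_eq_iff[of ?x ?y] *[of a b] by auto
  next
    case 2
    then have "sin ?x = sin (2 * pi * of_int (- b) / real n)"
      "cos ?x = cos (2 * pi * of_int (- b) / real n)"
      using assms(2) by auto
    then show ?thesis
      using sin_cos_eq_iff[of ?x "2 * pi * of_int (- b) / real n"] *[of a "- b"] by blast
  qed
qed

lemma real_gmod_rotation_module:
  assumes "group G" "n > 0" "hom_mod G n e"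
  shows "real_gmod G (rotation_module n e)"
proof -
  have "rotation (2 * pi * e (g \<otimes>\<^bsub>G\<^esub> h) / n)
      = rotation (2 * pi * e g / n) * rotation (2 * pi * e h / n)"
    if "g \<in> carrier G" "h \<in> carrier G" for g h
    using rotation_cong[OF assms(2) hom_mod_mult[OF assms(3) that]]
    by (simp add: add_divide_distrib distrib_left rotation_add)
  moreover have "rotation (2 * pi * e \<one>\<^bsub>G\<^esub> / n) = 1\<^sub>m 2"
    using rotation_cong[OF assms(2) hom_mod_one[OF assms(1,3)]] by (simp add: rotation_zero)
  ultimately show ?thesis
    by (auto simp: real_gmod_iff[OF assms(1)] rotation_module_def)
qed

lemma rotation_fixed_vec:
  assumes "v \<in> carrier_vec 2" "rotation t *\<^sub>v v = v" "cos t \<noteq> 1"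
  shows "v = 0\<^sub>v 2"
proof -
  \<comment> \<open>With \<open>a\<close> = 1 - cos t and \<open>b\<close> = sin t the two equations
    say that the vector (x, y) is killed by 1 - \<open>rotation t\<close>, whose determinant is
    \<open>a\<^sup>2 + b\<^sup>2\<close>.\<close>
  have *: "x = 0 \<and> y = 0" if "a * x = - (b * y)" "b * x = a * y" "a \<noteq> 0" for a b x y :: real
  proof -
    have "(a\<^sup>2 + b\<^sup>2) * x = a * (a * x) + b * (b * x)" "(a\<^sup>2 + b\<^sup>2) * y = a * (a * y) + b * (b * y)"
      by (simp_all add: power2_eq_square algebra_simps)
    moreover have "a * (a * x) + b * (b * x) = 0"
      unfolding that(1,2) by simp
    moreover have "a * (a * y) + b * (b * y) = 0"
      unfolding that(2)[symmetric] mult.left_commute[of a b x] that(1) by simp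
    moreover have "a\<^sup>2 + b\<^sup>2 \<noteq> 0"
      using that(3) by (simp add: sum_power2_eq_zero_iff)
    ultimately show ?thesis
      by (metis mult_eq_0_iff)
  qed
  have "cos t * v $ 0 - sin t * v $ 1 = v $ 0" "sin t * v $ 0 + cos t * v $ 1 = v $ 1"
    using arg_cong[OF assms(2), of "\<lambda>w. w $ 0"] arg_cong[OF assms(2), of "\<lambda>w. w $ 1"] assms(1)
    by (auto simp: rotation_def scalar_prod_def sum.atLeast_Suc_lessThan numeral_2_eq_2)
  then have "v $ 0 = 0 \<and> v $ 1 = 0"
    using assms(3) by (intro *[of "1 - cos t" _ "sin t"]) (auto simp: left_diff_distrib)
  then show ?thesis
    using assms(1) by (intro eq_vecI) (auto simp: less_2_iff)
qed

text \<open>Each O^r(G) contains some r-power of \<open>c\<close>. The last hypothesis makes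
  \<open>e\<close> nonzero modulo \<open>n\<close> there, so this element acts by a nontrivial
  rotation and fixes only the zero vector.\<close>

lemma large_free_rotation_module:
  assumes "group G" "finite (carrier G)" "n > 0" "hom_mod G n e" "c \<in> carrier G"
    and "\<And>m. prime_power m \<Longrightarrow> \<not> int n dvd int m * e c"
  shows "large_free G (rotation_module n e)"
  unfolding large_free_def
proof (intro allI impI)
  interpret group G by fact
  let ?V = "rotation_module n e"
  fix H assume "large_subgroup G H"
  then obtain r where H: "subgroup H G" and r: "prime r" "p_residual G r \<subseteq> H"
    by (auto simp: large_subgroup_def)
  interpret O: normal "p_residual G r" G
    by (rule p_residual_least(1)[OF assms(1,2) r(1)])
  interpret Q: group "G Mod p_residual G r"
    by (rule O.factorgroup_is_group)
  obtain k where k: "Coset.order (G Mod p_residual G r) = r ^ k"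
    using p_residual_least(2)[OF assms(1,2) r(1)] by (auto simp: Coset.order_def FactGroup_def)
  \<comment> \<open>The quotient by O^r(G) has order \<open>r ^ k\<close>, so raising
    \<open>c\<close> to this power gives an element of O^r(G), hence of \<open>H\<close>.\<close>
  let ?h = "c [^]\<^bsub>G\<^esub> (r ^ k)"
  have "p_residual G r #>\<^bsub>G\<^esub> ?h = p_residual G r"
    using O.FactGroup_pow[OF assms(5), of "r ^ k"] Q.pow_order_eq_1[of "p_residual G r #>\<^bsub>G\<^esub> c"]
      assms(5) k by (simp add: FactGroup_def RCOSETS_def) blast
  then have h: "?h \<in> H"
    using coset_join1[of "p_residual G r" ?h] assms(5) O.subgroup_axioms O.subset r(2) by auto
  have "\<not> int n dvd e ?h"
    using hom_mod_pow[OF assms(1,4,5), of "r ^ k"] assms(6)[of "r ^ k"] r(1)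
    by (auto simp: prime_power_def dest: cong_dvd_iff)
  then have cos: "cos (2 * pi * e ?h / real n) \<noteq> 1"
    using cos_eq_cong[OF assms(3), of "e ?h" 0] by (auto simp: cong_0_iff)
  have c: "snd ?V h \<in> carrier_mat (fst ?V) (fst ?V)" for h
    by (simp add: rotation_module_def)
  have "fixed_space H ?V = {0\<^sub>v (fst ?V)}"
  proof (intro equalityI subsetI)
    fix v assume "v \<in> fixed_space H ?V"
    then show "v \<in> {0\<^sub>v (fst ?V)}"
      using h rotation_fixed_vec[OF _ _ cos, of v]
      by (auto simp: fixed_space_def rotation_module_def)
  next
    fix v assume "v \<in> {0\<^sub>v (fst ?V) :: real vec}"
    moreover have "A *\<^sub>v 0\<^sub>v m = 0\<^sub>v m" if "A \<in> carrier_mat m m" for A :: "real mat" and m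
      using that by (intro eq_vecI) (auto simp: scalar_prod_def)
    ultimately show "v \<in> fixed_space H ?V"
      using c by (auto simp: fixed_space_def)
  qed
  then show "fixed_dim H ?V = 0"
    using fixed_dim_eq_0_iff[of H ?V, OF c] by simp
qed

lemma gmod_iso_rotation_cong:
  assumes "n > 0" "\<And>h. h \<in> H \<Longrightarrow> [e h = f h] (mod int n)"
  shows "gmod_iso H (rotation_module n e) (rotation_module n f)"
  using rotation_cong[OF assms] by (intro gmod_iso_eqI) (auto simp: rotation_module_def)

text \<open>The reflection \<open>T\<close> = diag(1, -1) is its own inverse and conjugates the
  rotation by -t into the rotation by t.\<close>

lemma gmod_iso_rotation_neg:
  assumes "n > 0" "\<And>h. h \<in> H \<Longrightarrow> [e h = - f h] (mod int n)"
  shows "gmod_iso H (rotation_module n e) (rotation_module n f)"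
proof -
  define T :: "real mat"
    where "T = mat 2 2 (\<lambda>(i, j). if i = j then if i = 0 then 1 else - 1 else 0)"
  have T: "T \<in> carrier_mat 2 2"
    by (simp add: T_def)
  have TT: "T * T = 1\<^sub>m 2"
    by (rule eq_matI)
      (auto simp: T_def less_2_iff scalar_prod_def sum.atLeast_Suc_lessThan numeral_2_eq_2)
  have "T * rotation (- t) = rotation t * T" for t
    by (rule eq_matI) (auto simp: T_def rotation_def less_2_iff scalar_prod_def
        sum.atLeast_Suc_lessThan numeral_2_eq_2)
  then show ?thesis
    unfolding gmod_iso_def using T TT rotation_cong[OF assms]
    by (intro bexI[of _ T]) (auto simp: rotation_module_def)
qed

section \<open>Traces as invariants of classes in RO(G)\<close>

definition mat_trace :: "'a::comm_ring_1 mat \<Rightarrow> 'a"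
  where "mat_trace A = (\<Sum>i<dim_row A. A $$ (i, i))"

lemma mat_trace_comm:
  assumes "A \<in> carrier_mat n m" "B \<in> carrier_mat m n"
  shows "mat_trace (A * B) = mat_trace (B * A)"
proof -
  have "mat_trace (A * B) = (\<Sum>i<n. \<Sum>j<m. A $$ (i, j) * B $$ (j, i))"
    using assms by (auto simp: mat_trace_def scalar_prod_def atLeast0LessThan intro!: sum.cong)
  also have "\<dots> = (\<Sum>j<m. \<Sum>i<n. B $$ (j, i) * A $$ (i, j))"
    by (subst sum.swap) (simp add: mult.commute)
  also have "\<dots> = mat_trace (B * A)"
    using assms by (auto simp: mat_trace_def scalar_prod_def atLeast0LessThan intro!: sum.cong)
  finally show ?thesis .
qed

lemma mat_trace_four_block:
  assumes "A \<in> carrier_mat n n" "D \<in> carrier_mat m m"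
  shows "mat_trace (four_block_mat A B C D) = mat_trace A + mat_trace D"
proof -
  have "mat_trace (four_block_mat A B C D) = (\<Sum>i<n + m. four_block_mat A B C D $$ (i, i))"
    using assms by (simp add: mat_trace_def)
  also have "\<dots> = (\<Sum>i<n. four_block_mat A B C D $$ (i, i))
      + (\<Sum>i<m. four_block_mat A B C D $$ (n + i, n + i))"
    by (simp add: lessThan_atLeast0 sum.atLeastLessThan_concat[of 0 n "n + m", symmetric]
        sum.atLeastLessThan_shift_0[of _ n "n + m"] comp_def)
  also have "\<dots> = mat_trace A + mat_trace D"
    using assms by (auto simp: mat_trace_def intro!: arg_cong2[where f = "(+)"] sum.cong)
  finally show ?thesis .
qed

lemma mat_trace_gmod_sum:
  assumes "snd U g \<in> carrier_mat (fst U) (fst U)" "snd V g \<in> carrier_mat (fst V) (fst V)"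
  shows "mat_trace (snd (U \<oplus>\<^sub>m V) g) = mat_trace (snd U g) + mat_trace (snd V g)"
  using mat_trace_four_block[OF assms] by (simp add: gmod_sum_def)

lemma mat_trace_gmod_iso:
  assumes "gmod_iso H U V" "h \<in> H"
    "snd U h \<in> carrier_mat (fst U) (fst U)" "snd V h \<in> carrier_mat (fst V) (fst V)"
  shows "mat_trace (snd U h) = mat_trace (snd V h)"
proof -
  let ?n = "fst U" and ?m = "fst V"
  obtain T S where T: "T \<in> carrier_mat ?m ?n" and S: "S \<in> carrier_mat ?n ?m"
    and TS: "T * S = 1\<^sub>m ?m" and ST: "S * T = 1\<^sub>m ?n" and eq: "T * snd U h = snd V h * T"
    using assms(1,2) unfolding gmod_iso_def by blast
  have "mat_trace (snd U h) = mat_trace ((S * T) * snd U h)"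
    using assms by (simp add: ST)
  also have "\<dots> = mat_trace (S * (snd V h * T))"
    using S T assms by (simp add: eq[symmetric])
  also have "\<dots> = mat_trace ((snd V h * T) * S)"
    using S T assms by (intro mat_trace_comm[of _ ?n ?m]) auto
  also have "(snd V h * T) * S = snd V h"
    using S T assms by (simp add: TS)
  finally show ?thesis .
qed

text \<open>A vanishing difference gives an isomorphism only after adding some module
  \<open>W\<close>. Traces are additive and invariant under isomorphism, so the contribution of
  \<open>W\<close> cancels, and no cancellation theorem for modules is required.\<close>

lemma mat_trace_gmod_diff_one:
  assumes "group G" "real_gmod G U" "real_gmod G V" "gmod_diff G U V = \<one>\<^bsub>RO G\<^esub>"
    and "g \<in> carrier G"
  shows "mat_trace (snd U g) = mat_trace (snd V g)"
proof -
  note s = real_gmod_sum[OF assms(1)] and z = real_gmod_zero[OF assms(1)]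
  note c = real_gmod_carrier[OF assms(1) _ assms(5)]
  obtain W where W: "real_gmod G W"
    "gmod_iso (carrier G) (U \<oplus>\<^sub>m gmod_zero \<oplus>\<^sub>m W) (gmod_zero \<oplus>\<^sub>m V \<oplus>\<^sub>m W)"
    using assms gmod_diff_eq_iff[OF assms(1-3) z z] by (auto simp: RO_one)
  have "mat_trace (snd (U \<oplus>\<^sub>m gmod_zero \<oplus>\<^sub>m W) g) = mat_trace (snd (gmod_zero \<oplus>\<^sub>m V \<oplus>\<^sub>m W) g)"
    using assms W(1) by (intro mat_trace_gmod_iso[OF W(2)] c s z) auto
  then show ?thesis
    using assms W(1) s z c by (simp add: mat_trace_gmod_sum)
qed

lemma mat_trace_rotation: "mat_trace (rotation t) = 2 * cos t"
  by (simp add: mat_trace_def rotation_def numeral_2_eq_2)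

section \<open>Two real conjugacy classes and a nonzero element of LO(G)\<close>

theorem theoremA2:
  fixes G :: "('g, 'b) monoid_scheme" and N :: "'g set" and p q :: nat
  assumes "group G" and "finite (carrier G)"
    and "prime p" and "odd p" and "prime q" and "odd q" and "p \<noteq> q"
    and "N \<lhd> G" and "cyclic_group (G Mod N)" and "Coset.order (G Mod N) = p * q"
  shows "laitinen_number G \<ge> 2 \<and> LO G \<noteq> {\<one>\<^bsub>RO G\<^esub>}"
proof
  interpret group G by fact
  let ?n = "p * q"
  obtain e c where e: "hom_mod G ?n e" and c: "c \<in> carrier G" "[e c = 1] (mod int ?n)"
    using cyclic_quotient_hom_mod[OF assms(8,9)] unfolding assms(10) by blast
  have gt: "p > 2" "q > 2"
    using assms(3-6) by (metis prime_ge_2_nat le_neq_implies_less even_numeral)+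
  then have n: "?n > 0"
    by simp
  have cop: "coprime p q"
    using primes_coprime assms by blast
  have cp: "[x = y] (mod int p)" if "[x = y] (mod int ?n)" for x y
    using cong_dvd_modulus[OF that] by simp
  have cq: "[x = y] (mod int q)" if "[x = y] (mod int ?n)" for x y
    using cong_dvd_modulus[OF that] by simp
  \<comment> \<open>This is where oddness enters: 1 and 2 are nonzero modulo both primes, so
    elements with \<open>e\<close> equal to 1 or 2 have orders that are not prime powers.\<close>
  have small: "\<not> int r dvd 1" "\<not> int r dvd 2" if "r > 2" for r
    using that zdvd_imp_le[of "int r" 1] zdvd_imp_le[of "int r" 2] by auto

  show "laitinen_number G \<ge> 2"
  proof -
    let ?d = "c [^]\<^bsub>G\<^esub> (2::nat)"
    have d: "?d \<in> carrier G"
      using c(1) by simp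
    have ed: "[e ?d = 2] (mod int ?n)"
      using hom_mod_pow[OF assms(1) e c(1), of 2] cong_scalar_left[OF c(2), of 2]
      by (auto intro: cong_trans)
    have "\<not> int p dvd e c" "\<not> int q dvd e c"
      using cong_dvd_iff[OF cp[OF c(2)]] cong_dvd_iff[OF cq[OF c(2)]] small gt by simp_all
    then have 1: "\<not> prime_power (ord c)"
      using not_prime_power_ord[OF assms(1) e assms(3,5,7) c(1)] by simp
    have "\<not> int p dvd e ?d" "\<not> int q dvd e ?d"
      using cong_dvd_iff[OF cp[OF ed]] cong_dvd_iff[OF cq[OF ed]] small gt by simp_all
    then have 2: "\<not> prime_power (ord ?d)"
      using not_prime_power_ord[OF assms(1) e assms(3,5,7) d] by simp
    have big: "int ?n > 3"
      using mult_le_mono[of 3 p 3 q] gt by linarith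
    have "(c, ?d) \<notin> real_conj G"
    proof
      assume "(c, ?d) \<in> real_conj G"
      \<comment> \<open>The invariant of \<open>hom_mod_real_conj\<close> is 1 at \<open>c\<close>
        and 2 at its square; equality up to sign would make \<open>p * q\<close> divide 1 or
        3.\<close>
      then have "[2 = 1] (mod int ?n) \<or> [2 = - 1] (mod int ?n)"
        using hom_mod_real_conj[OF assms(1) e, of c ?d] ed c(2)
        by (meson cong_minus_minus_iff cong_sym cong_trans)
      then have "int ?n dvd 1 \<or> int ?n dvd 3"
        by (auto simp: cong_iff_dvd_diff)
      then show False
        using big zdvd_imp_le[of "int ?n" 1] zdvd_imp_le[of "int ?n" 3] by linarith
    qed
    then show ?thesis
      using laitinen_number_ge_2[OF assms(1,2) c(1) d 1 2] by blast
  qed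

  show "LO G \<noteq> {\<one>\<^bsub>RO G\<^esub>}"
  proof -
    have "coprime (int p) (int q)"
      using cop by simp
    then obtain k where k: "[k = 1] (mod int p)" "[k = - 1] (mod int q)"
      using binary_chinese_remainder_int by blast
    \<comment> \<open>Since \<open>k\<close> is 1 or -1 modulo each prime, \<open>k * e c\<close> is
      divisible by neither prime, just like \<open>e c\<close>. By
      \<open>prime_power_dvd_coprime\<close> this makes both modules large-free.\<close>
    have kp: "\<not> int p dvd k * e c" and kq: "\<not> int q dvd k * e c"
      using cong_dvd_iff[OF cong_mult[OF k(1) cp[OF c(2)]]]
        cong_dvd_iff[OF cong_mult[OF k(2) cq[OF c(2)]]] small gt by simp_all
    have ep: "\<not> int p dvd e c" and eq: "\<not> int q dvd e c"
      using cong_dvd_iff[OF cp[OF c(2)]] cong_dvd_iff[OF cq[OF c(2)]] small gt by simp_all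
    let ?f = "\<lambda>g. k * e g"
    let ?U = "rotation_module ?n e" and ?V = "rotation_module ?n ?f"
    note f = hom_mod_scale[OF e, of k]
    have U: "real_gmod G ?U" and V: "real_gmod G ?V"
      using real_gmod_rotation_module[OF assms(1) n] e f by auto
    have "large_free G ?U"
      using prime_power_dvd_coprime[OF assms(3,5,7)] ep eq
      by (intro large_free_rotation_module[OF assms(1,2) n e c(1)]) blast
    moreover have "large_free G ?V"
      using prime_power_dvd_coprime[OF assms(3,5,7)] kp kq
      by (intro large_free_rotation_module[OF assms(1,2) n f c(1)]) blast
    moreover have "gmod_iso P ?U ?V" if P: "subgroup P G" "prime_power (card P)" for P
    proof -
      obtain r m where r: "prime r" "card P = r ^ m"
        using P(2) unfolding prime_power_def by blast
      \<comment> \<open>Lagrange in \<open>P\<close>: the power of \<open>h\<close> with exponent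
        \<open>card P\<close> is the identity, where \<open>e\<close> vanishes modulo
        \<open>p * q\<close>.\<close>
      have dvd: "int ?n dvd int (r ^ m) * e h" if "h \<in> P" for h
      proof -
        interpret P: group "G\<lparr>carrier := P\<rparr>"
          by (rule subgroup_imp_group[OF P(1)])
        have h: "h \<in> carrier G"
          using that P(1) subgroup.subset by blast
        have "h [^]\<^bsub>G\<^esub> card P = \<one>\<^bsub>G\<^esub>"
          using P.pow_order_eq_1[of h] that by (simp add: Coset.order_def nat_pow_consistent[symmetric])
        then show ?thesis
          using hom_mod_pow[OF assms(1) e h, of "card P"] hom_mod_one[OF assms(1) e]
          unfolding r(2) by simp (metis cong_0_iff cong_sym cong_trans)
      qed
      \<comment> \<open>A prime factor \<open>s\<close> of \<open>p * q\<close> other than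
        \<open>r\<close> is coprime to the factor \<open>r ^ m\<close>, which can therefore be
        cancelled.\<close>
      have dvd_s: "int s dvd e h" if "prime s" "s \<noteq> r" "int s dvd int ?n" "h \<in> P" for s h
      proof -
        have "coprime (int s) (int (r ^ m))"
          using that r primes_coprime[of s r] by simp
        then show ?thesis
          using dvd_trans[OF that(3) dvd[OF that(4)]] coprime_dvd_mult_right_iff by blast
      qed
      have div_n: "int ?n dvd x" if "int p dvd x" "int q dvd x" for x
        using that cop by (simp add: divides_mult)
      show ?thesis
      proof (cases "p = r")
        case True
        have "[e h = k * e h] (mod int ?n)" if "h \<in> P" for h
        proof -
          \<comment> \<open>Here \<open>p\<close> divides 1 - \<open>k\<close>, and
            \<open>q\<close>, being different from \<open>r\<close>, divides
            \<open>e h\<close>.\<close>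
          have "int p dvd (1 - k) * e h" "int q dvd (1 - k) * e h"
            using cong_sym[OF k(1)] dvd_s[of q h] that assms True
            by (auto simp: cong_iff_dvd_diff)
          then show ?thesis
            using div_n by (simp add: cong_iff_dvd_diff algebra_simps)
        qed
        then show ?thesis
          by (intro gmod_iso_rotation_cong n)
      next
        \<comment> \<open>This case contains r = q as well as primes \<open>r\<close> outside {p,
          q}. In both, \<open>p\<close> divides \<open>e h\<close>, while \<open>q\<close> divides 1
          + \<open>k\<close>.\<close>
        case False
        have "[e h = - (k * e h)] (mod int ?n)" if "h \<in> P" for h
        proof -
          have "int q dvd (1 + k) * e h" "int p dvd (1 + k) * e h"
            using k(2) dvd_s[of p h] that assms False
            by (auto simp: cong_iff_dvd_diff add.commute)
          then show ?thesis
            using div_n by (simp add: cong_iff_dvd_diff algebra_simps)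
        qed
        then show ?thesis
          by (intro gmod_iso_rotation_neg n)
      qed
    qed
    ultimately have "gmod_diff G ?U ?V \<in> LO G"
      unfolding LO_def using U V by blast
    moreover have "gmod_diff G ?U ?V \<noteq> \<one>\<^bsub>RO G\<^esub>"
    proof
      assume "gmod_diff G ?U ?V = \<one>\<^bsub>RO G\<^esub>"
      from mat_trace_gmod_diff_one[OF assms(1) U V this c(1)]
      have "cos (2 * pi * e c / real ?n) = cos (2 * pi * of_int (k * e c) / real ?n)"
        by (simp add: rotation_module_def mat_trace_rotation)
      then have "[e c = k * e c] (mod int ?n) \<or> [e c = - (k * e c)] (mod int ?n)"
        by (rule cos_eq_cong[OF n])
      \<comment> \<open>Each alternative is read modulo the prime where \<open>k\<close> has the
        opposite sign: \<open>q\<close> for the first, \<open>p\<close> for the second. As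
        \<open>e c\<close> is 1 there, 1 = -1 results, which is impossible for an odd prime.\<close>
      then have "[1 = - 1] (mod int q) \<or> [1 = - 1] (mod int p)"
      proof
        assume "[e c = k * e c] (mod int ?n)"
        then have "[1 = - 1] (mod int q)"
          using cq cong_mult[OF k(2) cq[OF c(2)]] c(2)
          by (metis cong_sym cong_trans mult.right_neutral)
        then show ?thesis ..
      next
        assume "[e c = - (k * e c)] (mod int ?n)"
        then have "[1 = - 1] (mod int p)"
          using cp cong_mult[OF k(1) cp[OF c(2)]] c(2)
          by (metis cong_minus_minus_iff cong_sym cong_trans mult.right_neutral)
        then show ?thesis ..
      qed
      then show False
        using small gt by (auto simp: cong_iff_dvd_diff)
    qed
    ultimately show ?thesis
      by blast
  qed
qed

end
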